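(* Let $\mathbb{K}$ be $\mathbb{R}$ or $\mathbb{C}$. The characteristic Lie algebras $\chi(\sinh u)$ and $\chi(e^u+e^{-2u})$ of the sinh-Gordon equation $u_{xy}=\sinh u$ and of the Tzitzeica equation $u_{xy}=e^u+e^{-2u}$ are Lie algebras of linear growth with average growth rates $\frac32$ and $\frac43$ respectively, i.e. their growth functions satisfy $$\lim_{n\to+\infty}\frac{F_{\chi(\sinh u)}(n)}{n}=\frac32,\qquad \lim_{n\to+\infty}\frac{F_{\chi(e^u+e^{-2u})}(n)}{n}=\frac43 .$$
   Context: **Characteristic Lie algebra.** Let $\Omega\subset\mathbb{R}$ be an open domain (nonempty open interval), $C^{\omega}(\Omega)$ the $\mathbb{K}$-algebra of analytic $\mathbb{K}$-valued functions of one real variable $u\in\Omega$, and $C^{\omega}(\Omega)[u_1,u_2,\dots]$ the algebra of polynomials in infinitely many variables $u_1,u_2,\dots$ with coefficients in $C^{\omega}(\Omega)$. Put $$D=u_1\frac{\partial}{\partial u}+\sum_{k\ge 1}u_{k+1}\frac{\partial}{\partial u_k}.$$ For $f\in C^{\omega}(\Omega)$, the characteristic Lie algebra $\chi(f)$ of the equation $u_{xy}=f(u)$ is the Lie algebra over $\mathbb{K}$ (under the commutator of derivations of $C^{\omega}(\Omega)[u_1,u_2,\dots]$) generated by the two (formal, infinite) vector fields $$X_0=\frac{\partial}{\partial u},\qquad X_1=X(f)=\sum_{n=1}^{+\infty}D^{n-1}(f)\frac{\partial}{\partial u_n}.$$ **Growth function.** For a Lie algebra $\mathfrak{g}$ generated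 by a finite-dimensional subspace $V_1(\mathfrak{g})$, let $V_n(\mathfrak{g})$ be the $\mathbb{K}$-linear span of all products of elements of $V_1(\mathfrak{g})$ of length at most $n$ with arbitrary arrangements of brackets; the growth function is $F_{\mathfrak{g}}(n)=\dim V_n(\mathfrak{g})$. For $\mathfrak{g}=\chi(f)$ with $f=\sinh u$ or $f=e^u+e^{-2u}$, the generating subspace is $V_1(\chi(f))=\langle X_0,X_1,[X_0,X_1]\rangle$, i.e. the sum of $\langle X_0\rangle$ and of the smallest $\mathrm{ad}\,X_0$-invariant subspace containing $X_1$. *)

theory Defs
  imports
    "HOL-Analysis.Analysis"
    "HOL-Library.Function_Algebras"
    "HOL-Library.Poly_Mapping"
    "HOL-Library.Landau_Symbols"
begin

text \<open>
  The ground field is a type \<open>'k\<close>, to be instantiated with \<open>real\<close> or \<open>complex\<close>.  A function on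
  \<open>\<Omega>\<close> is represented by its extension by zero to the whole line, so that equality on \<open>\<Omega>\<close>
  is equality in the logic.
\<close>

definition cutoff :: "real set \<Rightarrow> (real \<Rightarrow> 'k::zero) \<Rightarrow> real \<Rightarrow> 'k" where
  "cutoff \<Omega> f = (\<lambda>u. if u \<in> \<Omega> then f u else 0)"

definition analytic_functions :: "real set \<Rightarrow> (real \<Rightarrow> 'k::real_normed_field) set" where
  "analytic_functions \<Omega> =
     {f. (\<forall>x\<in>\<Omega>. \<exists>a. \<forall>\<^sub>F y in nhds x. (\<lambda>n. a n * of_real (y - x) ^ n) sums f y) \<and>
         (\<forall>x. x \<notin> \<Omega> \<longrightarrow> f x = 0)}"

text \<open>
  Polynomials in \<open>u\<^sub>1, u\<^sub>2, \<dots>\<close> are finitely supported families of coefficients indexed by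
  monomials, a monomial being a finitely supported family of exponents.  Variables are indexed
  from 0: index \<open>k\<close> stands for \<open>u\<^bsub>k+1\<^esub>\<close>.
\<close>

type_synonym 'k dpoly = "(nat \<Rightarrow>\<^sub>0 nat) \<Rightarrow>\<^sub>0 (real \<Rightarrow> 'k)"

definition dpolys :: "real set \<Rightarrow> 'k::real_normed_field dpoly set" where
  "dpolys \<Omega> = {p. \<forall>m. Poly_Mapping.lookup p m \<in> analytic_functions \<Omega>}"

definition coef_poly :: "real set \<Rightarrow> (real \<Rightarrow> 'k::real_normed_field) \<Rightarrow> 'k dpoly" where
  "coef_poly \<Omega> f = Poly_Mapping.single 0 (cutoff \<Omega> f)"

definition var_poly :: "real set \<Rightarrow> nat \<Rightarrow> 'k::real_normed_field dpoly" where
  "var_poly \<Omega> k = Poly_Mapping.single (Poly_Mapping.single k 1) (cutoff \<Omega> (\<lambda>_. 1))"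

definition pderiv_u :: "real set \<Rightarrow> 'k::real_normed_field dpoly \<Rightarrow> 'k dpoly" where
  "pderiv_u \<Omega> p = Poly_Mapping.map (\<lambda>g. cutoff \<Omega> (\<lambda>u. vector_derivative g (at u))) p"

definition pderiv_var :: "nat \<Rightarrow> 'k::real_normed_field dpoly \<Rightarrow> 'k dpoly" where
  "pderiv_var k p =
     (\<Sum>m\<in>Poly_Mapping.keys p.
        Poly_Mapping.single (m - Poly_Mapping.single k 1) (of_nat (Poly_Mapping.lookup m k) * Poly_Mapping.lookup p m))"

text \<open>
  \<open>Sum_any\<close> is the sum over the support of its argument; the supports here are finite because a
  polynomial involves only finitely many variables.
\<close>

definition total_D :: "real set \<Rightarrow> 'k::real_normed_field dpoly \<Rightarrow> 'k dpoly" where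
  "total_D \<Omega> p =
     var_poly \<Omega> 0 * pderiv_u \<Omega> p +
     Sum_any (\<lambda>k. var_poly \<Omega> (Suc k) * pderiv_var k p)"

text \<open>
  Vector fields are operators on \<open>dpolys \<Omega>\<close>, represented by their extension by zero to the whole
  type.
\<close>

type_synonym 'k vfield = "'k dpoly \<Rightarrow> 'k dpoly"

definition scale_poly :: "'k::real_normed_field \<Rightarrow> 'k dpoly \<Rightarrow> 'k dpoly" where
  "scale_poly c p = Poly_Mapping.single 0 (\<lambda>_. c) * p"

definition scale_vf :: "'k::real_normed_field \<Rightarrow> 'k vfield \<Rightarrow> 'k vfield" where
  "scale_vf c X = (\<lambda>p. scale_poly c (X p))"

lemma scale_poly_axioms:
  fixes a b :: "'k::real_normed_field" and p q :: "'k dpoly"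
  shows "scale_poly a (p + q) = scale_poly a p + scale_poly a q"
    and "scale_poly (a + b) p = scale_poly a p + scale_poly b p"
    and "scale_poly a (scale_poly b p) = scale_poly (a * b) p"
    and "scale_poly 1 p = p"
proof -
  have sum: "(\<lambda>_. a + b) = (\<lambda>_::real. a) + (\<lambda>_. b)"
    and prod: "(\<lambda>_. a * b) = (\<lambda>_::real. a) * (\<lambda>_. b)"
    and one: "(\<lambda>_. 1) = (1 :: real \<Rightarrow> 'k)"
    by (simp_all add: fun_eq_iff)
  show "scale_poly a (p + q) = scale_poly a p + scale_poly a q"
    by (simp add: scale_poly_def distrib_left)
  show "scale_poly (a + b) p = scale_poly a p + scale_poly b p"
    by (simp add: scale_poly_def sum single_add distrib_right)
  show "scale_poly a (scale_poly b p) = scale_poly (a * b) p"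
    by (simp add: scale_poly_def prod mult_single flip: mult.assoc)
  show "scale_poly 1 p = p"
    by (simp add: scale_poly_def one)
qed

interpretation vf: vector_space "scale_vf :: 'k::real_normed_field \<Rightarrow> 'k vfield \<Rightarrow> 'k vfield"
  by standard (simp_all add: scale_vf_def scale_poly_axioms fun_eq_iff)

definition bracket :: "'k::real_normed_field vfield \<Rightarrow> 'k vfield \<Rightarrow> 'k vfield" where
  "bracket X Y = (\<lambda>p. X (Y p) - Y (X p))"

definition derivations :: "real set \<Rightarrow> 'k::real_normed_field vfield set" where
  "derivations \<Omega> =
     {X. (\<forall>p\<in>dpolys \<Omega>. X p \<in> dpolys \<Omega>) \<and>
         (\<forall>p. p \<notin> dpolys \<Omega> \<longrightarrow> X p = 0) \<and>
         (\<forall>p\<in>dpolys \<Omega>. \<forall>q\<in>dpolys \<Omega>. X (p + q) = X p + X q) \<and>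
         (\<forall>c. \<forall>p\<in>dpolys \<Omega>. X (scale_poly c p) = scale_poly c (X p)) \<and>
         (\<forall>p\<in>dpolys \<Omega>. \<forall>q\<in>dpolys \<Omega>. X (p * q) = X p * q + p * X q)}"

definition lie_subalgebra :: "real set \<Rightarrow> 'k::real_normed_field vfield set \<Rightarrow> bool" where
  "lie_subalgebra \<Omega> L \<longleftrightarrow>
     L \<subseteq> derivations \<Omega> \<and> vf.subspace L \<and> (\<forall>X\<in>L. \<forall>Y\<in>L. bracket X Y \<in> L)"

definition X0 :: "real set \<Rightarrow> 'k::real_normed_field vfield" where
  "X0 \<Omega> = (\<lambda>p. if p \<in> dpolys \<Omega> then pderiv_u \<Omega> p else 0)"

definition X1 :: "real set \<Rightarrow> (real \<Rightarrow> 'k::real_normed_field) \<Rightarrow> 'k vfield" where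
  "X1 \<Omega> f = (\<lambda>p. if p \<in> dpolys \<Omega>
     then Sum_any (\<lambda>n. (total_D \<Omega> ^^ n) (coef_poly \<Omega> f) * pderiv_var n p) else 0)"

definition char_lie_algebra ::
    "real set \<Rightarrow> (real \<Rightarrow> 'k::real_normed_field) \<Rightarrow> 'k vfield set" where
  "char_lie_algebra \<Omega> f = lie_subalgebra \<Omega> hull {X0 \<Omega>, X1 \<Omega> f}"

text \<open>
  The generating subspace for those \<open>f\<close>, such as the two considered here, for which the span of
  \<open>X\<^sub>1\<close> and \<open>[X\<^sub>0, X\<^sub>1]\<close> is invariant under \<open>ad X\<^sub>0\<close>.
\<close>

definition char_gen_space ::
    "real set \<Rightarrow> (real \<Rightarrow> 'k::real_normed_field) \<Rightarrow> 'k vfield set" where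
  "char_gen_space \<Omega> f = vf.span {X0 \<Omega>, X1 \<Omega> f, bracket (X0 \<Omega>) (X1 \<Omega> f)}"

inductive lie_product :: "'k::real_normed_field vfield set \<Rightarrow> nat \<Rightarrow> 'k vfield \<Rightarrow> bool"
  for V where
  base: "X \<in> V \<Longrightarrow> lie_product V 1 X"
| step: "lie_product V m X \<Longrightarrow> lie_product V n Y \<Longrightarrow> lie_product V (m + n) (bracket X Y)"

definition lie_filtration :: "'k::real_normed_field vfield set \<Rightarrow> nat \<Rightarrow> 'k vfield set" where
  "lie_filtration V n = vf.span {X. \<exists>m\<le>n. lie_product V m X}"

text \<open>\<open>vf.dim\<close> is 0 on infinite-dimensional spaces; \<open>linear_growth\<close> below rules these out.\<close>

definition growth_function :: "'k::real_normed_field vfield set \<Rightarrow> nat \<Rightarrow> nat" where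
  "growth_function V n = vf.dim (lie_filtration V n)"

definition linear_growth ::
    "real set \<Rightarrow> 'k::real_normed_field vfield set \<Rightarrow> 'k vfield set \<Rightarrow> bool" where
  "linear_growth \<Omega> L V \<longleftrightarrow>
     lie_subalgebra \<Omega> L \<and>
     (\<exists>B. finite B \<and> V = vf.span B) \<and> L = lie_subalgebra \<Omega> hull V \<and>
     (\<lambda>n. real (growth_function V n)) \<in> \<Theta>(\<lambda>n. real n)"

end

theory Submission
  imports Defs
begin

text \<open>
  Both functions have the shape \<open>f = a e\<^sup>\<alpha>\<^sup>u + b e\<^sup>\<beta>\<^sup>u\<close>, and \<open>\<chi>(f)\<close> is spanned by \<open>X\<^sub>0\<close> together with the
  Lie algebra generated by the two fields \<open>X(e\<^sup>\<alpha>\<^sup>u)\<close> and \<open>X(e\<^sup>\<beta>\<^sup>u)\<close>.  For \<open>(\<alpha>, \<beta>) = (1, -1)\<close> and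
  \<open>(1, -2)\<close> the latter is the positive part of the affine Kac--Moody algebra \<open>A\<^sub>1\<^sup>(\<^sup>1\<^sup>)\<close>,
  respectively \<open>A\<^sub>2\<^sup>(\<^sup>2\<^sup>)\<close>.  All its root spaces are lines, and they can be numbered by
  positive integers so that brackets become \<open>[\<phi>\<^sub>i, \<phi>\<^sub>j] = c\<^sub>i\<^sub>j \<phi>\<^bsub>i+j\<^esub>\<close> with \<open>c\<close> periodic of period 3,
  respectively 8, in both indices; \<open>\<phi>\<^sub>0\<close> is \<open>X\<^sub>0\<close>.

  The tool is the total derivative \<open>D\<close>.  It commutes with \<open>X\<^sub>0\<close>, it satisfies \<open>[X(g), D] = g X\<^sub>0\<close>,
  and a field annihilating all functions of \<open>u\<close> and commuting with \<open>D\<close> is zero, because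
  \<open>u\<^bsub>k+1\<^esub> = D u\<^sub>k\<close>.  In the affine algebra, \<open>D\<close> acts like a combination of the two negative
  Chevalley generators with coefficients \<open>e\<^sup>\<alpha>\<^sup>u\<close> and \<open>e\<^sup>\<beta>\<^sup>u\<close>.  So fields \<open>\<phi>\<^sub>i\<close> are constructed by
  recursion on their coefficients such that

    \<open>[\<phi>\<^sub>i, D] = p\<^sub>i e\<^sup>\<alpha>\<^sup>u \<phi>\<^bsub>i-1\<^esub> + q\<^sub>i e\<^sup>\<beta>\<^sup>u \<phi>\<^bsub>i-2\<^esub>\<close>,

  where \<open>p\<^sub>i\<close> and \<open>q\<^sub>i\<close> are the structure constants of these generators (lemma \<open>\<phi>_D\<close>).  The
  commutator of \<open>D\<close> with \<open>[\<phi>\<^sub>i, \<phi>\<^sub>j] - c\<^sub>i\<^sub>j \<phi>\<^bsub>i+j\<^esub>\<close> is then a combination of fields of the same form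
  with smaller indices, by the Jacobi identity in the affine algebra; an induction shows that they
  all vanish (lemma \<open>bracket_\<phi>\<close>).

  For linear independence, give each \<open>\<phi>\<^sub>i\<close> its principal degree \<open>deg i\<close> and its weight \<open>w\<^sub>i\<close> under
  \<open>ad X\<^sub>0\<close>.  The basis is scaled so that \<open>p\<^sub>i + q\<^sub>i = 1\<close>, which makes \<open>e\<close> to the power \<open>w\<^sub>i u\<close> the
  first nonzero coefficient of \<open>\<phi>\<^sub>i\<close>, at position \<open>deg i\<close> (lemma \<open>coeff_leading\<close>).  Weights separate the
  fields of equal degree, so the \<open>\<phi>\<^sub>i\<close> are independent.

  Since the bracket adds degrees and each \<open>\<phi>\<^sub>i\<close> with \<open>i \<ge> 3\<close> is a multiple of \<open>[\<phi>\<^sub>1, \<phi>\<^bsub>i-1\<^esub>]\<close> or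
  \<open>[\<phi>\<^sub>2, \<phi>\<^bsub>i-2\<^esub>]\<close> of degree one less, \<open>V\<^sub>n\<close> is the span of the \<open>\<phi>\<^sub>i\<close> with \<open>deg i \<le> n\<close>.  Hence the growth
  function counts indices: three of them for every two degrees, respectively eight for every six.
\<close>

section \<open>Analytic functions of a real variable\<close>

text \<open>
  Convergence near \<open>x\<close> is recorded for arguments in the whole ground field, absolutely, because
  Cauchy products need absolute convergence and termwise differentiation takes place in \<open>'k\<close> even
  when the function lives on the real line.
\<close>

definition power_series_at :: "(real \<Rightarrow> 'k::real_normed_field) \<Rightarrow> real \<Rightarrow> (nat \<Rightarrow> 'k) \<Rightarrow> real \<Rightarrow> bool" where
  "power_series_at f x a r \<longleftrightarrow> 0 < r \<and>
     (\<forall>z. norm z < r \<longrightarrow> summable (\<lambda>n. norm (a n * z ^ n))) \<and>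
     (\<forall>y. \<bar>y - x\<bar> < r \<longrightarrow> f y = (suminf (\<lambda>n. a n * of_real (y - x) ^ n)))"

lemma power_series_at_of_eventually:
  fixes f :: "real \<Rightarrow> 'k::{real_normed_field,banach}"
  assumes "\<forall>\<^sub>F y in nhds x. (\<lambda>n. a n * of_real (y - x) ^ n) sums f y"
  obtains r where "power_series_at f x a r"
proof -
  from assms obtain e where e: "e > 0"
      "\<And>y. dist y x < e \<Longrightarrow> (\<lambda>n. a n * of_real (y - x) ^ n) sums f y"
    unfolding eventually_nhds_metric by blast
  have "(\<lambda>n. a n * of_real (x + e/2 - x) ^ n) sums f (x + e/2)"
    using e by (intro e) (simp add: dist_real_def)
  then have s: "summable (\<lambda>n. a n * of_real (e/2) ^ n)"
    by (simp add: sums_iff)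
  have "summable (\<lambda>n. norm (a n * z ^ n))" if "norm z < e/2" for z :: 'k
    using powser_insidea[OF s, of z] that e(1) by simp
  moreover have "f y = (suminf (\<lambda>n. a n * of_real (y - x) ^ n))" if "\<bar>y - x\<bar> < e/2" for y
    using e(2)[of y] that e(1) by (simp add: dist_real_def sums_iff)
  ultimately have "power_series_at f x a (e/2)"
    using e(1) by (simp add: power_series_at_def)
  then show ?thesis by (rule that)
qed

lemma power_series_at_imp_eventually:
  fixes f :: "real \<Rightarrow> 'k::{real_normed_field,banach}"
  assumes "power_series_at f x a r"
  shows "\<forall>\<^sub>F y in nhds x. (\<lambda>n. a n * of_real (y - x) ^ n) sums f y"
  unfolding eventually_nhds_metric
proof (intro exI[of _ r] conjI allI impI)
  show "r > 0" using assms by (simp add: power_series_at_def)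
  fix y assume d: "dist y x < r"
  then have "norm (of_real (y - x) :: 'k) < r"
    by (simp add: dist_real_def del: of_real_diff)
  then have "summable (\<lambda>n. norm (a n * of_real (y - x) ^ n))"
    using assms unfolding power_series_at_def by blast
  then have "summable (\<lambda>n. a n * of_real (y - x) ^ n)" by (rule summable_norm_cancel)
  then show "(\<lambda>n. a n * of_real (y - x) ^ n) sums f y"
    using assms d by (simp add: power_series_at_def dist_real_def sums_iff)
qed

lemma analytic_functions_iff:
  fixes f :: "real \<Rightarrow> 'k::{real_normed_field,banach}"
  shows "f \<in> analytic_functions \<Omega> \<longleftrightarrow>
    (\<forall>x\<in>\<Omega>. \<exists>a r. power_series_at f x a r) \<and> (\<forall>x. x \<notin> \<Omega> \<longrightarrow> f x = 0)"
proof -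
  have "(\<exists>a. \<forall>\<^sub>F y in nhds x. (\<lambda>n. a n * of_real (y - x) ^ n) sums f y) \<longleftrightarrow> (\<exists>a r. power_series_at f x a r)" for x
    using power_series_at_of_eventually[of _ x f] power_series_at_imp_eventually[of f x] by metis
  then show ?thesis by (simp add: analytic_functions_def)
qed

lemma power_series_at_mult:
  fixes f g :: "real \<Rightarrow> 'k::{real_normed_field,banach}"
  assumes "power_series_at f x a r" "power_series_at g x b s"
  shows "\<forall>\<^sub>F y in nhds x. (\<lambda>n. (\<Sum>i\<le>n. a i * b (n - i)) * of_real (y - x) ^ n) sums (f y * g y)"
  unfolding eventually_nhds_metric
proof (intro exI[of _ "min r s"] conjI allI impI)
  show "min r s > 0" using assms by (simp add: power_series_at_def)
  fix y assume d: "dist y x < min r s"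
  define z :: 'k where "z = of_real (y - x)"
  have nz: "norm z < r" "norm z < s" "\<bar>y - x\<bar> < r" "\<bar>y - x\<bar> < s"
    using d by (simp_all add: z_def dist_real_def del: of_real_diff)
  have "(\<lambda>k. \<Sum>i\<le>k. (a i * z ^ i) * (b (k - i) * z ^ (k - i))) sums
      ((suminf (\<lambda>k. a k * z ^ k) * (suminf (\<lambda>k. b k * z ^ k))))"
    using assms nz by (intro Cauchy_product_sums) (auto simp: power_series_at_def)
  moreover have "(\<Sum>i\<le>k. (a i * z ^ i) * (b (k - i) * z ^ (k - i))) = (\<Sum>i\<le>k. a i * b (k - i)) * z ^ k" for k
    unfolding sum_distrib_right by (intro sum.cong) (simp_all flip: power_add)
  moreover have "f y = (suminf (\<lambda>k. a k * z ^ k))" "g y = (suminf (\<lambda>k. b k * z ^ k))"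
    using assms nz by (auto simp: power_series_at_def z_def)
  ultimately show "(\<lambda>n. (\<Sum>i\<le>n. a i * b (n - i)) * of_real (y - x) ^ n) sums (f y * g y)"
    by (simp add: z_def)
qed

text \<open>
  The series is differentiated in \<open>'k\<close> and then composed with the embedding of the reals.
\<close>

lemma power_series_at_deriv:
  fixes f :: "real \<Rightarrow> 'k::{real_normed_field,banach}"
  assumes "power_series_at f x a r" "\<bar>y - x\<bar> < r"
  shows "(f has_vector_derivative (suminf (\<lambda>n. diffs a n * of_real (y - x) ^ n))) (at y)"
    and "summable (\<lambda>n. diffs a n * of_real (y - x) ^ n :: 'k)"
proof -
  have S: "summable (\<lambda>n. a n * z ^ n)" if "norm z < r" for z
    using assms(1) that by (auto simp: power_series_at_def intro: summable_norm_cancel)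
  have n: "norm (of_real (y - x) :: 'k) < r"
    using assms(2) by (simp del: of_real_diff)
  have "((\<lambda>z. suminf (\<lambda>n. a n * z ^ n)) has_field_derivative (suminf (\<lambda>n. diffs a n * of_real (y - x) ^ n)))
      (at (of_real (y - x)))"
    by (rule termdiffs_strong'[OF S n])
  then have "((\<lambda>z. suminf (\<lambda>n. a n * z ^ n)) has_field_derivative (suminf (\<lambda>n. diffs a n * of_real (y - x) ^ n)))
      (at (of_real (y - x)) within UNIV)" by simp
  then have "((\<lambda>z. suminf (\<lambda>n. a n * z ^ n)) \<circ> (\<lambda>y. of_real (y - x)) has_vector_derivative
      1 * (suminf (\<lambda>n. diffs a n * of_real (y - x) ^ n))) (at y)"
    by (intro field_vector_diff_chain_at) (auto intro!: derivative_eq_intros)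
  then have *: "((\<lambda>y. suminf (\<lambda>n. a n * of_real (y - x) ^ n)) has_vector_derivative
      (suminf (\<lambda>n. diffs a n * of_real (y - x) ^ n))) (at y)"
    by (simp add: o_def)
  show "(f has_vector_derivative (suminf (\<lambda>n. diffs a n * of_real (y - x) ^ n))) (at y)"
    by (rule has_vector_derivative_transform_within_open[OF *, of "ball x r"])
       (use assms in \<open>auto simp: power_series_at_def dist_real_def abs_minus_commute\<close>)
  show "summable (\<lambda>n. diffs a n * of_real (y - x) ^ n :: 'k)"
    by (rule termdiff_converges[OF n S])
qed

definition deriv_on :: "real set \<Rightarrow> (real \<Rightarrow> 'k::real_normed_field) \<Rightarrow> real \<Rightarrow> 'k" where
  "deriv_on \<Omega> g = cutoff \<Omega> (\<lambda>u. vector_derivative g (at u))"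

definition exp_fun :: "real set \<Rightarrow> 'k \<Rightarrow> real \<Rightarrow> 'k::{real_normed_field,banach}" where
  "exp_fun \<Omega> c = cutoff \<Omega> (\<lambda>u. exp (c * of_real u))"

locale open_domain =
  fixes \<Omega> :: "real set"
  assumes open_\<Omega>: "open \<Omega>"
begin

lemma eventually_in_\<Omega>: "x \<in> \<Omega> \<Longrightarrow> \<forall>\<^sub>F y in nhds x. y \<in> \<Omega>"
  using open_\<Omega> by (simp add: eventually_nhds) blast

lemma analytic_cutoff:
  fixes f :: "real \<Rightarrow> 'k::{real_normed_field,banach}"
  assumes "\<And>x. x \<in> \<Omega> \<Longrightarrow> \<exists>a. \<forall>\<^sub>F y in nhds x. (\<lambda>n. a n * of_real (y - x) ^ n) sums f y"
  shows "cutoff \<Omega> f \<in> analytic_functions \<Omega>"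
proof -
  have "\<exists>a. \<forall>\<^sub>F y in nhds x. (\<lambda>n. a n * of_real (y - x) ^ n) sums cutoff \<Omega> f y" if x: "x \<in> \<Omega>" for x
  proof -
    from assms[OF x] obtain a where "\<forall>\<^sub>F y in nhds x. (\<lambda>n. a n * of_real (y - x) ^ n) sums f y" by blast
    then have "\<forall>\<^sub>F y in nhds x. (\<lambda>n. a n * of_real (y - x) ^ n) sums cutoff \<Omega> f y"
      using eventually_in_\<Omega>[OF x] by eventually_elim (simp add: cutoff_def)
    then show ?thesis by blast
  qed
  then show ?thesis by (simp add: analytic_functions_def cutoff_def)
qed

lemma analytic_zero [simp]: "0 \<in> analytic_functions \<Omega>"
  unfolding analytic_functions_def by (auto simp: zero_fun_def intro!: exI[of _ "\<lambda>_. 0"])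

lemma analytic_add:
  assumes "f \<in> analytic_functions \<Omega>" "g \<in> analytic_functions \<Omega>"
  shows "f + g \<in> analytic_functions \<Omega>"
proof -
  have "\<exists>c. \<forall>\<^sub>F y in nhds x. (\<lambda>n. c n * of_real (y - x) ^ n) sums (f y + g y)" if "x \<in> \<Omega>" for x
  proof -
    from assms(1) that obtain a where "\<forall>\<^sub>F y in nhds x. (\<lambda>n. a n * of_real (y - x) ^ n) sums f y"
      unfolding analytic_functions_def by blast
    moreover from assms(2) that obtain b where "\<forall>\<^sub>F y in nhds x. (\<lambda>n. b n * of_real (y - x) ^ n) sums g y"
      unfolding analytic_functions_def by blast
    ultimately have "\<forall>\<^sub>F y in nhds x. (\<lambda>n. (a n + b n) * of_real (y - x) ^ n) sums (f y + g y)"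
      by eventually_elim (simp add: sums_add distrib_right)
    then show ?thesis by (intro exI)
  qed
  then show ?thesis using assms by (simp add: analytic_functions_def)
qed

lemma analytic_mult:
  fixes f g :: "real \<Rightarrow> 'k::{real_normed_field,banach}"
  assumes "f \<in> analytic_functions \<Omega>" "g \<in> analytic_functions \<Omega>"
  shows "f * g \<in> analytic_functions \<Omega>"
proof -
  have "\<exists>c. \<forall>\<^sub>F y in nhds x. (\<lambda>n. c n * of_real (y - x) ^ n) sums (f y * g y)" if "x \<in> \<Omega>" for x
    proof -
    from assms(1) that obtain a r where "power_series_at f x a r"
      unfolding analytic_functions_iff by blast
    moreover from assms(2) that obtain b s where "power_series_at g x b s"
      unfolding analytic_functions_iff by blast
    ultimately show ?thesis by (intro exI) (rule power_series_at_mult)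
  qed
  then show ?thesis using assms by (simp add: analytic_functions_def)
qed

lemma analytic_uminus:
  fixes f :: "real \<Rightarrow> 'k::{real_normed_field,banach}"
  assumes "f \<in> analytic_functions \<Omega>"
  shows "- f \<in> analytic_functions \<Omega>"
proof -
  have "\<exists>c. \<forall>\<^sub>F y in nhds x. (\<lambda>n. c n * of_real (y - x) ^ n) sums (- f y)" if "x \<in> \<Omega>" for x
  proof -
    from assms that obtain a where "\<forall>\<^sub>F y in nhds x. (\<lambda>n. a n * of_real (y - x) ^ n) sums f y"
      unfolding analytic_functions_def by blast
    then have "\<forall>\<^sub>F y in nhds x. (\<lambda>n. (- a n) * of_real (y - x) ^ n) sums (- f y)"
      by eventually_elim (simp add: sums_minus)
    then show ?thesis by (intro exI)
  qed
  then show ?thesis using assms by (simp add: analytic_functions_def)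
qed

lemma analytic_const [simp]: "cutoff \<Omega> (\<lambda>_. c :: 'k::{real_normed_field,banach}) \<in> analytic_functions \<Omega>"
proof (intro analytic_cutoff exI)
  fix x
  show "\<forall>\<^sub>F y in nhds x. (\<lambda>n. (if n = 0 then c else 0) * of_real (y - x) ^ n) sums c"
  proof (intro always_eventually allI)
    fix y :: real
    have "(\<lambda>n. if n = 0 then c else 0) sums c" by (rule sums_single)
    moreover have "(\<lambda>n. (if n = 0 then c else 0) * of_real (y - x) ^ n) = (\<lambda>n. if n = 0 then c else 0)"
      by (rule ext) simp
    ultimately show "(\<lambda>n. (if n = 0 then c else 0) * of_real (y - x) ^ n) sums c" by simp
  qed
qed

lemma analytic_exp [simp]: "exp_fun \<Omega> (c :: 'k::{real_normed_field,banach}) \<in> analytic_functions \<Omega>"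
  unfolding exp_fun_def
proof (intro analytic_cutoff exI)
  fix x
  have "(\<lambda>n. exp (c * of_real x) * c ^ n / fact n * of_real (y - x) ^ n) sums exp (c * of_real y)" for y
  proof -
    have "(\<lambda>n. exp (c * of_real x) * ((c * of_real (y - x)) ^ n /\<^sub>R fact n)) sums
        (exp (c * of_real x) * exp (c * of_real (y - x)))"
      by (intro sums_mult exp_converges)
    moreover have "exp (c * of_real x) * exp (c * of_real (y - x)) = exp (c * of_real y)"
      by (simp add: algebra_simps flip: exp_add)
    moreover have "exp (c * of_real x) * ((c * of_real (y - x)) ^ n /\<^sub>R fact n) =
        exp (c * of_real x) * c ^ n / fact n * of_real (y - x) ^ n" for n
      by (simp add: power_mult_distrib scaleR_conv_of_real divide_inverse mult_ac)
    ultimately show ?thesis by simp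
  qed
  then show "\<forall>\<^sub>F y in nhds x. (\<lambda>n. exp (c * of_real x) * c ^ n / fact n * of_real (y - x) ^ n) sums exp (c * of_real y)"
    by simp
qed

lemma analytic_differentiable:
  fixes f :: "real \<Rightarrow> 'k::{real_normed_field,banach}"
  assumes "f \<in> analytic_functions \<Omega>" "x \<in> \<Omega>"
  shows "(f has_vector_derivative deriv_on \<Omega> f x) (at x)"
proof -
  obtain a r where "power_series_at f x a r"
    using assms by (auto simp: analytic_functions_iff)
  then have "f differentiable at x"
    using power_series_at_deriv(1)[of f x a r x] by (auto simp: power_series_at_def intro: differentiableI_vector)
  then show ?thesis
    using assms by (simp add: deriv_on_def cutoff_def flip: vector_derivative_works)
qed

lemma deriv_on_eqI:
  assumes "\<And>x. x \<in> \<Omega> \<Longrightarrow> (f has_vector_derivative g x) (at x)" "\<And>x. x \<notin> \<Omega> \<Longrightarrow> g x = 0"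
  shows "deriv_on \<Omega> f = g"
  using assms by (auto simp: deriv_on_def cutoff_def fun_eq_iff intro: vector_derivative_at)

lemma analytic_deriv:
  fixes f :: "real \<Rightarrow> 'k::{real_normed_field,banach}"
  assumes "f \<in> analytic_functions \<Omega>"
  shows "deriv_on \<Omega> f \<in> analytic_functions \<Omega>"
  unfolding deriv_on_def
proof (rule analytic_cutoff)
  fix x assume "x \<in> \<Omega>"
  then obtain a r where a: "power_series_at f x a r"
    using assms by (auto simp: analytic_functions_iff)
  have "(\<lambda>n. diffs a n * of_real (y - x) ^ n) sums vector_derivative f (at y)" if "dist y x < r" for y
    using power_series_at_deriv[OF a, of y] that by (simp add: dist_real_def vector_derivative_at summable_sums)
  then show "\<exists>a. \<forall>\<^sub>F y in nhds x. (\<lambda>n. a n * of_real (y - x) ^ n) sums vector_derivative f (at y)"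
    using a unfolding eventually_nhds_metric power_series_at_def by blast
qed

lemma deriv_on_add:
  fixes f g :: "real \<Rightarrow> 'k::{real_normed_field,banach}"
  assumes "f \<in> analytic_functions \<Omega>" "g \<in> analytic_functions \<Omega>"
  shows "deriv_on \<Omega> (f + g) = deriv_on \<Omega> f + deriv_on \<Omega> g"
  unfolding plus_fun_def
  by (intro deriv_on_eqI has_vector_derivative_add analytic_differentiable assms) 
     (auto simp: deriv_on_def cutoff_def)

lemma deriv_on_mult:
  fixes f g :: "real \<Rightarrow> 'k::{real_normed_field,banach}"
  assumes "f \<in> analytic_functions \<Omega>" "g \<in> analytic_functions \<Omega>"
  shows "deriv_on \<Omega> (f * g) = deriv_on \<Omega> f * g + f * deriv_on \<Omega> g"
proof (rule deriv_on_eqI)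
  fix x assume "x \<in> \<Omega>"
  then have "((\<lambda>x. f x * g x) has_vector_derivative (f x * deriv_on \<Omega> g x + deriv_on \<Omega> f x * g x)) (at x)"
    by (intro has_vector_derivative_mult analytic_differentiable assms)
  then show "(f * g has_vector_derivative (deriv_on \<Omega> f * g + f * deriv_on \<Omega> g) x) (at x)"
    by (simp add: times_fun_def add.commute)
qed (simp add: deriv_on_def cutoff_def)

lemma deriv_on_const [simp]: "deriv_on \<Omega> (cutoff \<Omega> (\<lambda>_. c)) = 0"
proof (rule deriv_on_eqI)
  fix x assume "x \<in> \<Omega>"
  show "(cutoff \<Omega> (\<lambda>_. c) has_vector_derivative 0 x) (at x)"
    by (rule has_vector_derivative_transform_within_open[OF _ open_\<Omega> \<open>x \<in> \<Omega>\<close>, of "\<lambda>_. c"])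
       (auto simp: cutoff_def)
qed simp

lemma deriv_on_zero [simp]: "deriv_on \<Omega> 0 = 0"
  by (intro deriv_on_eqI) (simp_all add: zero_fun_def)

lemma deriv_on_exp:
  "deriv_on \<Omega> (exp_fun \<Omega> c) = cutoff \<Omega> (\<lambda>_. c :: 'k::{real_normed_field,banach}) * exp_fun \<Omega> c"
proof (rule deriv_on_eqI)
  fix x assume "x \<in> \<Omega>"
  have "(exp has_field_derivative exp (c * of_real x)) (at (c * of_real x) within UNIV)"
    by (simp add: DERIV_exp)
  then have "(exp \<circ> (\<lambda>u. c * of_real u) has_vector_derivative (c * 1) * exp (c * of_real x)) (at x)"
    by (intro field_vector_diff_chain_at has_vector_derivative_mult_right) 
       (auto intro!: derivative_eq_intros)
  then have *: "((\<lambda>u. exp (c * of_real u)) has_vector_derivative c * exp (c * of_real x)) (at x)"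
    by (simp add: o_def)
  show "(exp_fun \<Omega> c has_vector_derivative (cutoff \<Omega> (\<lambda>_. c) * exp_fun \<Omega> c) x) (at x)"
    by (rule has_vector_derivative_transform_within_open[OF _ open_\<Omega> \<open>x \<in> \<Omega>\<close>, of "\<lambda>u. exp (c * of_real u)"])
       (use * \<open>x \<in> \<Omega>\<close> in \<open>auto simp: cutoff_def exp_fun_def\<close>)
qed (simp add: cutoff_def)

end

section \<open>Differential polynomials\<close>

lemma poly_mapping_sum_single:
  "p = (\<Sum>m\<in>Poly_Mapping.keys p. Poly_Mapping.single m (Poly_Mapping.lookup p m))"
  by (rule poly_mapping_eqI)
    (simp add: lookup_sum lookup_single when_def in_keys_iff)

text \<open>
  Bilinear identities need only be checked on monomials.
\<close>

lemma poly_mapping_additive_induct [case_names zero single add]: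
  fixes p :: "'a \<Rightarrow>\<^sub>0 'b::comm_monoid_add"
  assumes "P 0" "\<And>m g. P (Poly_Mapping.single m g)" "\<And>p q. P p \<Longrightarrow> P q \<Longrightarrow> P (p + q)"
  shows "P p"
proof -
  have "P (\<Sum>m\<in>A. Poly_Mapping.single m (Poly_Mapping.lookup p m))" if "finite A" for A
    using that by (induction A) (simp_all add: assms)
  from this[of "Poly_Mapping.keys p"] show ?thesis
    by (simp flip: poly_mapping_sum_single)
qed

lemma pderiv_var_superset:
  assumes "finite A" "Poly_Mapping.keys p \<subseteq> A"
  shows "pderiv_var k p = (\<Sum>m\<in>A.
    Poly_Mapping.single (m - Poly_Mapping.single k 1) (of_nat (Poly_Mapping.lookup m k) * Poly_Mapping.lookup p m))"
  unfolding pderiv_var_def using assms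
  by (intro sum.mono_neutral_left) (auto simp: in_keys_iff)

lemma pderiv_var_zero [simp]: "pderiv_var k 0 = 0"
  by (simp add: pderiv_var_def)

lemma pderiv_var_single [simp]:
  "pderiv_var k (Poly_Mapping.single m g) =
    Poly_Mapping.single (m - Poly_Mapping.single k 1) (of_nat (Poly_Mapping.lookup m k) * g)"
  by (simp add: pderiv_var_superset[of "{m}"])

lemma pderiv_var_add: "pderiv_var k (p + q) = pderiv_var k p + pderiv_var k q"
proof -
  define A where "A = Poly_Mapping.keys p \<union> Poly_Mapping.keys q"
  have "finite A" "Poly_Mapping.keys p \<subseteq> A" "Poly_Mapping.keys q \<subseteq> A" "Poly_Mapping.keys (p + q) \<subseteq> A"
    using keys_add[of p q] by (auto simp: A_def)
  then show ?thesis
    by (simp add: pderiv_var_superset[of A] lookup_add distrib_left single_add sum.distrib)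
qed

lemma single_minus_single_add:
  fixes a b :: "nat \<Rightarrow>\<^sub>0 nat"
  assumes "Poly_Mapping.lookup a k \<noteq> 0"
  shows "a + b - Poly_Mapping.single k 1 = (a - Poly_Mapping.single k 1) + b"
  using assms by (intro poly_mapping_eqI) (auto simp: lookup_add lookup_minus lookup_single when_def)

lemma pderiv_var_mult_single:
  "pderiv_var k (Poly_Mapping.single a f * Poly_Mapping.single b g) =
    pderiv_var k (Poly_Mapping.single a f) * Poly_Mapping.single b g +
    Poly_Mapping.single a f * pderiv_var k (Poly_Mapping.single b g)"
proof -
  let ?e = "Poly_Mapping.single k (1::nat)"
  let ?A = "Poly_Mapping.lookup a k" and ?B = "Poly_Mapping.lookup b k"
  have 1: "Poly_Mapping.single (a - ?e + b) (of_nat ?A * f * g) = Poly_Mapping.single (a + b - ?e) (of_nat ?A * f * g)"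
    using single_minus_single_add[of a k b] by (cases "?A = 0") simp_all
  have 2: "Poly_Mapping.single (a + (b - ?e)) (f * (of_nat ?B * g)) = Poly_Mapping.single (a + b - ?e) (of_nat ?B * f * g)"
    using single_minus_single_add[of b k a] by (cases "?B = 0") (simp_all add: ac_simps)
  show ?thesis
    by (simp only: mult_single pderiv_var_single 1 2)
       (simp add: lookup_add distrib_right mult.assoc flip: single_add)
qed

lemma pderiv_var_mult: "pderiv_var k (p * q) = pderiv_var k p * q + p * pderiv_var k q"
proof (induction p rule: poly_mapping_additive_induct)
  case (single a f)
  show ?case
  proof (induction q rule: poly_mapping_additive_induct)
    case (single b g)
    show ?case by (rule pderiv_var_mult_single)
  qed (simp_all add: pderiv_var_add algebra_simps)
qed (simp_all add: pderiv_var_add algebra_simps)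

lemma finite_pderiv_var: "finite {k. pderiv_var k p \<noteq> 0}"
proof (rule finite_subset)
  show "finite (\<Union>m\<in>Poly_Mapping.keys p. Poly_Mapping.keys m)" by simp
  have "\<exists>m\<in>Poly_Mapping.keys p. Poly_Mapping.lookup m k \<noteq> 0" if "pderiv_var k p \<noteq> 0" for k
    using that by (rule contrapos_np) (simp add: pderiv_var_def)
  then show "{k. pderiv_var k p \<noteq> 0} \<subseteq> (\<Union>m\<in>Poly_Mapping.keys p. Poly_Mapping.keys m)"
    by (force simp: in_keys_iff)
qed

text \<open>
  The part of a vector field that differentiates along the variables \<open>u\<^sub>1, u\<^sub>2, \<dots>\<close> only.
\<close>

definition vertical :: "(nat \<Rightarrow> 'k::real_normed_field dpoly) \<Rightarrow> 'k dpoly \<Rightarrow> 'k dpoly" where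
  "vertical P p = Sum_any (\<lambda>k. P k * pderiv_var k p)"

lemma finite_vertical: "finite {k. P k * pderiv_var k p \<noteq> 0}"
  by (rule finite_subset[OF _ finite_pderiv_var[of p]]) auto

lemma vertical_eq_sum: "vertical P p = (\<Sum>k\<in>{k. pderiv_var k p \<noteq> 0}. P k * pderiv_var k p)"
  unfolding vertical_def by (rule Sum_any.expand_superset[OF finite_pderiv_var]) auto

lemma vertical_zero [simp]: "vertical P 0 = 0"
  by (simp add: vertical_def)

lemma vertical_add: "vertical P (p + q) = vertical P p + vertical P q"
  unfolding vertical_def
  by (simp add: pderiv_var_add distrib_left Sum_any.distrib[OF finite_vertical finite_vertical])

lemma vertical_mult: "vertical P (p * q) = vertical P p * q + p * vertical P q"
proof -
  have f: "finite {k. P k * pderiv_var k p * q \<noteq> 0}" for p q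
    by (rule finite_subset[OF _ finite_pderiv_var[of p]]) auto
  have "vertical P (p * q) = Sum_any (\<lambda>k. P k * pderiv_var k p * q + P k * pderiv_var k q * p)"
    unfolding vertical_def by (intro Sum_any.cong) (simp add: pderiv_var_mult algebra_simps)
  also have "\<dots> = Sum_any (\<lambda>k. P k * pderiv_var k p * q) + Sum_any (\<lambda>k. P k * pderiv_var k q * p)"
    by (intro Sum_any.distrib f)
  also have "\<dots> = vertical P p * q + vertical P q * p"
    unfolding vertical_def by (simp add: Sum_any_left_distrib[OF finite_vertical])
  finally show ?thesis by (simp add: mult.commute)
qed

lemma vertical_coef [simp]: "vertical P (Poly_Mapping.single 0 g) = 0"
  unfolding vertical_def by simp

lemma vertical_scale: "vertical P (scale_poly c p) = scale_poly c (vertical P p)"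
  by (simp add: scale_poly_def vertical_mult)

lemma pderiv_var_var:
  "pderiv_var j (var_poly \<Omega> k) = (if j = k then coef_poly \<Omega> (\<lambda>_. 1) else 0)"
  by (simp add: var_poly_def coef_poly_def lookup_single when_def)

lemma vertical_var: "vertical P (var_poly \<Omega> k) = P k * coef_poly \<Omega> (\<lambda>_. 1)"
proof -
  have "vertical P (var_poly \<Omega> k) = Sum_any (\<lambda>j. if j = k then P j * coef_poly \<Omega> (\<lambda>_. 1) else 0)"
    unfolding vertical_def by (intro Sum_any.cong) (simp add: pderiv_var_var)
  then show ?thesis by simp
qed

context open_domain
begin

lemma dpolys_single [simp]:
  "Poly_Mapping.single m g \<in> dpolys \<Omega> \<longleftrightarrow> g \<in> analytic_functions \<Omega>"
  by (auto simp: dpolys_def lookup_single when_def dest: spec[of _ m])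

lemma dpolys_zero [simp]: "0 \<in> dpolys \<Omega>"
  by (simp add: dpolys_def)

lemma dpolys_add [simp]: "p \<in> dpolys \<Omega> \<Longrightarrow> q \<in> dpolys \<Omega> \<Longrightarrow> p + q \<in> dpolys \<Omega>"
  by (simp add: dpolys_def lookup_add analytic_add)

lemma dpolys_uminus [simp]: 
  "p \<in> dpolys \<Omega> \<Longrightarrow> - p \<in> dpolys \<Omega>" for p :: "'k::{real_normed_field,banach} dpoly"
  by (simp add: dpolys_def analytic_uminus)

lemma dpolys_diff [simp]: 
  "p \<in> dpolys \<Omega> \<Longrightarrow> q \<in> dpolys \<Omega> \<Longrightarrow> p - q \<in> dpolys \<Omega>" for p :: "'k::{real_normed_field,banach} dpoly"
  using dpolys_add[of p "- q"] by simp

lemma dpolys_sum: "(\<And>i. i \<in> A \<Longrightarrow> f i \<in> dpolys \<Omega>) \<Longrightarrow> sum f A \<in> dpolys \<Omega>"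
  by (induction A rule: infinite_finite_induct) simp_all

lemma dpolys_induct [consumes 1, case_names zero single add]:
  assumes p: "p \<in> dpolys \<Omega>" and "P 0"
    and "\<And>m g. g \<in> analytic_functions \<Omega> \<Longrightarrow> P (Poly_Mapping.single m g)"
    and "\<And>p q. p \<in> dpolys \<Omega> \<Longrightarrow> q \<in> dpolys \<Omega> \<Longrightarrow> P p \<Longrightarrow> P q \<Longrightarrow> P (p + q)"
  shows "P p"
proof -
  have a: "Poly_Mapping.lookup p m \<in> analytic_functions \<Omega>" for m
    using p by (simp add: dpolys_def)
  have "P (\<Sum>m\<in>A. Poly_Mapping.single m (Poly_Mapping.lookup p m)) \<and>
      (\<Sum>m\<in>A. Poly_Mapping.single m (Poly_Mapping.lookup p m)) \<in> dpolys \<Omega>" if "finite A" for A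
    using that by (induction A) (simp_all add: assms a)
  from this[of "Poly_Mapping.keys p"] show ?thesis
    by (simp flip: poly_mapping_sum_single)
qed

lemma dpolys_mult [simp]:
  fixes p :: "'k::{real_normed_field,banach} dpoly"
  assumes "p \<in> dpolys \<Omega>" "q \<in> dpolys \<Omega>"
  shows "p * q \<in> dpolys \<Omega>"
  using assms(1)
proof (induction p rule: dpolys_induct)
  case (single a f)
  show ?case using assms(2) single
    by (induction q rule: dpolys_induct) (simp_all add: mult_single analytic_mult distrib_left)
qed (simp_all add: distrib_right)

lemma analytic_of_nat_mult:
  fixes g :: "real \<Rightarrow> 'k::{real_normed_field,banach}"
  assumes "g \<in> analytic_functions \<Omega>" shows "of_nat n * g \<in> analytic_functions \<Omega>"
proof (induction n)
  case (Suc n)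
  have eq: "of_nat (Suc n) * g = g + of_nat n * g" by (simp add: distrib_right)
  show ?case unfolding eq by (rule analytic_add[OF assms Suc])
next
  case 0
  have "of_nat 0 * g = 0" by (simp add: fun_eq_iff)
  then show ?case by (simp only: analytic_zero)
qed

lemma dpolys_pderiv_var [simp]:
  fixes p :: "'k::{real_normed_field,banach} dpoly"
  shows "p \<in> dpolys \<Omega> \<Longrightarrow> pderiv_var k p \<in> dpolys \<Omega>"
  by (induction p rule: dpolys_induct) (simp_all add: pderiv_var_add analytic_of_nat_mult)

lemma dpolys_vertical [simp]:
  fixes p :: "'k::{real_normed_field,banach} dpoly"
  shows "p \<in> dpolys \<Omega> \<Longrightarrow> (\<And>k. P k \<in> dpolys \<Omega>) \<Longrightarrow> vertical P p \<in> dpolys \<Omega>"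
  by (simp add: vertical_eq_sum dpolys_sum)

lemma dpolys_coef_const [simp]: "coef_poly \<Omega> (\<lambda>_. c) \<in> dpolys \<Omega>" for c :: "'k::{real_normed_field,banach}"
  by (simp add: coef_poly_def)

lemma dpolys_var [simp]: "var_poly \<Omega> k \<in> (dpolys \<Omega> :: 'k::{real_normed_field,banach} dpoly set)"
  by (simp add: var_poly_def)

lemma analytic_const_mult:
  fixes g :: "real \<Rightarrow> 'k::{real_normed_field,banach}"
  assumes "g \<in> analytic_functions \<Omega>"
  shows "cutoff \<Omega> (\<lambda>_. c) * g = (\<lambda>_. c) * g" "cutoff \<Omega> (\<lambda>_. 1) * g = g"
  using assms by (auto simp: cutoff_def analytic_functions_def fun_eq_iff)

text \<open>
  The constant function and its cutoff differ as coefficients, but not as multipliers of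
  polynomials whose coefficients vanish outside \<open>\<Omega>\<close>.
\<close>

lemma scale_poly_eq_mult:
  fixes p :: "'k::{real_normed_field,banach} dpoly"
  assumes "p \<in> dpolys \<Omega>"
  shows "scale_poly c p = coef_poly \<Omega> (\<lambda>_. c) * p"
  using assms by (induction p rule: dpolys_induct)
    (simp_all add: scale_poly_def coef_poly_def mult_single analytic_const_mult(1) distrib_left)

lemma coef_one_mult [simp]:
  fixes p :: "'k::{real_normed_field,banach} dpoly"
  assumes "p \<in> dpolys \<Omega>"
  shows "coef_poly \<Omega> (\<lambda>_. 1) * p = p" "p * coef_poly \<Omega> (\<lambda>_. 1) = p"
proof -
  show "coef_poly \<Omega> (\<lambda>_. 1) * p = p"
    using assms by (induction p rule: dpolys_induct)
      (simp_all add: coef_poly_def mult_single analytic_const_mult(2) distrib_left)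
  then show "p * coef_poly \<Omega> (\<lambda>_. 1) = p" by (simp add: mult.commute)
qed

lemma dpolys_scale [simp]:
  "p \<in> dpolys \<Omega> \<Longrightarrow> scale_poly c p \<in> dpolys \<Omega>" for p :: "'k::{real_normed_field,banach} dpoly"
  by (simp add: scale_poly_eq_mult)

lemma lookup_pderiv_u:
  "Poly_Mapping.lookup (pderiv_u \<Omega> p) m = deriv_on \<Omega> (Poly_Mapping.lookup p m)"
proof (cases "Poly_Mapping.lookup p m = 0")
  case True
  then show ?thesis by (simp add: pderiv_u_def map.rep_eq)
qed (simp add: pderiv_u_def map.rep_eq when_def deriv_on_def)

lemma dpolys_pderiv_u [simp]:
  "p \<in> dpolys \<Omega> \<Longrightarrow> pderiv_u \<Omega> p \<in> dpolys \<Omega>" for p :: "'k::{real_normed_field,banach} dpoly"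
  by (simp add: dpolys_def lookup_pderiv_u analytic_deriv)

lemma pderiv_u_zero [simp]: "pderiv_u \<Omega> 0 = 0"
  by (rule poly_mapping_eqI) (simp add: lookup_pderiv_u)

lemma pderiv_u_add:
  fixes p :: "'k::{real_normed_field,banach} dpoly"
  assumes "p \<in> dpolys \<Omega>" "q \<in> dpolys \<Omega>"
  shows "pderiv_u \<Omega> (p + q) = pderiv_u \<Omega> p + pderiv_u \<Omega> q"
  using assms by (intro poly_mapping_eqI) (simp add: lookup_pderiv_u lookup_add deriv_on_add dpolys_def)

lemma pderiv_u_single [simp]:
  "pderiv_u \<Omega> (Poly_Mapping.single m g) = Poly_Mapping.single m (deriv_on \<Omega> g)"
  by (intro poly_mapping_eqI) (simp add: lookup_pderiv_u lookup_single when_def)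

lemma pderiv_u_mult:
  fixes p :: "'k::{real_normed_field,banach} dpoly"
  assumes "p \<in> dpolys \<Omega>" "q \<in> dpolys \<Omega>"
  shows "pderiv_u \<Omega> (p * q) = pderiv_u \<Omega> p * q + p * pderiv_u \<Omega> q"
  using assms(1)
proof (induction p rule: dpolys_induct)
  case (single a f)
  note f = single
  show ?case using assms(2)
  proof (induction q rule: dpolys_induct)
    case (single b g)
    then show ?case using f by (simp add: mult_single deriv_on_mult single_add)
  next
    case (add p q)
    then show ?case using f by (simp add: distrib_left pderiv_u_add)
  qed simp
next
  case (add p q)
  then show ?case using assms(2) by (simp add: distrib_right pderiv_u_add)
qed simp

lemma pderiv_u_const [simp]: "pderiv_u \<Omega> (coef_poly \<Omega> (\<lambda>_. c)) = 0"
  by (simp add: coef_poly_def)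

lemma pderiv_u_var [simp]: "pderiv_u \<Omega> (var_poly \<Omega> k) = 0"
  by (simp add: var_poly_def)

lemma pderiv_u_scale:
  "p \<in> dpolys \<Omega> \<Longrightarrow> pderiv_u \<Omega> (scale_poly c p) = scale_poly c (pderiv_u \<Omega> p)"
  for p :: "'k::{real_normed_field,banach} dpoly"
  by (simp add: scale_poly_eq_mult pderiv_u_mult)

end

section \<open>Derivations of the algebra of differential polynomials\<close>

definition vector_field ::
    "real set \<Rightarrow> 'k::real_normed_field dpoly \<Rightarrow> (nat \<Rightarrow> 'k dpoly) \<Rightarrow> 'k vfield" where
  "vector_field \<Omega> g P = (\<lambda>p. if p \<in> dpolys \<Omega> then g * pderiv_u \<Omega> p + vertical P p else 0)"

lemma scale_poly_mult: "scale_poly c p * q = scale_poly c (p * q)" "p * scale_poly c q = scale_poly c (p * q)"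
  by (simp_all add: scale_poly_def ac_simps)

lemma scale_poly_diff: "scale_poly c (p - q) = scale_poly c p - scale_poly c q"
  by (simp add: scale_poly_def right_diff_distrib)

lemma scale_poly_0_right [simp]: "scale_poly c 0 = 0"
  by (simp add: scale_poly_def)

lemma derivationsD:
  assumes "X \<in> derivations \<Omega>"
  shows "p \<in> dpolys \<Omega> \<Longrightarrow> X p \<in> dpolys \<Omega>"
    and "p \<notin> dpolys \<Omega> \<Longrightarrow> X p = 0"
    and "p \<in> dpolys \<Omega> \<Longrightarrow> q \<in> dpolys \<Omega> \<Longrightarrow> X (p + q) = X p + X q"
    and "p \<in> dpolys \<Omega> \<Longrightarrow> X (scale_poly c p) = scale_poly c (X p)"
    and "p \<in> dpolys \<Omega> \<Longrightarrow> q \<in> dpolys \<Omega> \<Longrightarrow> X (p * q) = X p * q + p * X q"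
  using assms by (simp_all add: derivations_def)

context open_domain
begin

lemma derivation_zero:
  assumes "X \<in> derivations \<Omega>" shows "X 0 = 0"
  using derivationsD(3)[OF assms, of 0 0] by simp

lemma derivation_uminus:
  fixes p :: "'k::{real_normed_field,banach} dpoly"
  assumes "X \<in> derivations \<Omega>" "p \<in> dpolys \<Omega>" shows "X (- p) = - X p" 
  using derivationsD(3)[OF assms(1), of p "- p"] assms derivation_zero[OF assms(1)]
  by (simp add: eq_neg_iff_add_eq_0 add.commute)

lemma derivation_diff:
  fixes p q :: "'k::{real_normed_field,banach} dpoly"
  assumes "X \<in> derivations \<Omega>" "p \<in> dpolys \<Omega>" "q \<in> dpolys \<Omega>" shows "X (p - q) = X p - X q" 
  using derivationsD(3)[OF assms(1), of p "- q"] assms derivation_uminus[OF assms(1)]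
  by simp

lemma derivations_add:
  fixes X Y :: "'k::{real_normed_field,banach} vfield"
  assumes "X \<in> derivations \<Omega>" "Y \<in> derivations \<Omega>" shows "(\<lambda>p. X p + Y p) \<in> derivations \<Omega>"
  using assms unfolding derivations_def by (simp add: algebra_simps scale_poly_axioms)

lemma derivations_mult:
  fixes X :: "'k::{real_normed_field,banach} vfield"
  assumes "X \<in> derivations \<Omega>" "r \<in> dpolys \<Omega>" shows "(\<lambda>p. r * X p) \<in> derivations \<Omega>"
  using assms unfolding derivations_def by (simp add: algebra_simps scale_poly_mult)

lemma derivations_scale:
  fixes X :: "'k::{real_normed_field,banach} vfield"
  assumes "X \<in> derivations \<Omega>" shows "scale_vf c X \<in> derivations \<Omega>"
  using assms unfolding derivations_def scale_vf_def
  by (simp add: scale_poly_axioms scale_poly_mult mult.commute)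

lemma derivations_0: "(\<lambda>p. 0) \<in> derivations \<Omega>"
  unfolding derivations_def by simp

lemma derivations_bracket:
  fixes X Y :: "'k::{real_normed_field,banach} vfield"
  assumes "X \<in> derivations \<Omega>" "Y \<in> derivations \<Omega>" shows "bracket X Y \<in> derivations \<Omega>"
proof -
  note d = derivationsD[OF assms(1)] derivationsD[OF assms(2)] derivation_zero[OF assms(1)] derivation_zero[OF assms(2)]
  show ?thesis
    unfolding derivations_def bracket_def
    by (intro CollectI conjI ballI allI impI) (simp_all add: d algebra_simps scale_poly_diff)
qed

lemma lie_subalgebra_derivations: "lie_subalgebra \<Omega> (derivations \<Omega> :: 'k::{real_normed_field,banach} vfield set)"
  unfolding lie_subalgebra_def vf.subspace_def
  using derivations_0 derivations_add derivations_scale derivations_bracket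
  by (auto simp: zero_fun_def plus_fun_def)

text \<open>
  Coefficients and variables generate the algebra.  This turns every identity between vector fields
  below into a check on \<open>g(u)\<close> and on the \<open>u\<^sub>k\<close>.
\<close>

lemma derivation_eqI:
  fixes X Y :: "'k::{real_normed_field,banach} vfield"
  assumes X: "X \<in> derivations \<Omega>" and Y: "Y \<in> derivations \<Omega>"
    and coef: "\<And>g. g \<in> analytic_functions \<Omega> \<Longrightarrow> X (Poly_Mapping.single 0 g) = Y (Poly_Mapping.single 0 g)"
    and var: "\<And>k. X (var_poly \<Omega> k) = Y (var_poly \<Omega> k)"
  shows "X = Y"
proof
  fix p
  have mult: "X (p * q) = Y (p * q)" if "X p = Y p" "X q = Y q" "p \<in> dpolys \<Omega>" "q \<in> dpolys \<Omega>" for p q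
    using that by (simp add: derivationsD(5)[OF X] derivationsD(5)[OF Y])
  have one: "cutoff \<Omega> (\<lambda>_. 1 :: 'k) \<in> analytic_functions \<Omega>" by simp
  have pow: "X (Poly_Mapping.single (Poly_Mapping.single k v) g) = Y (Poly_Mapping.single (Poly_Mapping.single k v) g)"
    if "g \<in> analytic_functions \<Omega>" for k v g
  proof (induction v)
    case 0
    then show ?case using coef[OF that] by simp
  next
    case (Suc v)
    have "Poly_Mapping.single (Poly_Mapping.single k (Suc v)) g =
        var_poly \<Omega> k * Poly_Mapping.single (Poly_Mapping.single k v) g"
      by (simp add: var_poly_def mult_single analytic_const_mult(2)[OF that] flip: single_add)
    then show ?case using mult[OF var Suc] that by simp
  qed
  have mono: "\<forall>g\<in>analytic_functions \<Omega>. X (Poly_Mapping.single m g) = Y (Poly_Mapping.single m g)" for m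
  proof (induction m rule: poly_mapping_additive_induct)
    case (add m n)
    have "Poly_Mapping.single (m + n) g = Poly_Mapping.single m g * Poly_Mapping.single n (cutoff \<Omega> (\<lambda>_. 1))"
      if "g \<in> analytic_functions \<Omega>" for g :: "real \<Rightarrow> 'k"
      using analytic_const_mult(2)[OF that] by (simp add: mult_single mult.commute)
    then show ?case using add one by (auto intro!: mult)
  qed (use coef pow in auto)
  show "X p = Y p"
  proof (cases "p \<in> dpolys \<Omega>")
    case True
    then show ?thesis
    proof (induction p rule: dpolys_induct)
      case zero
      then show ?case by (simp add: derivation_zero[OF X] derivation_zero[OF Y])
    next
      case (single m g)
      then show ?case using mono by blast
    next
      case (add p q)
      then show ?case by (simp add: derivationsD(3)[OF X] derivationsD(3)[OF Y])
    qed
  next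
    case False
    then show ?thesis by (simp add: derivationsD(2)[OF X] derivationsD(2)[OF Y])
  qed
qed

lemma vector_field_derivation:
  fixes g :: "'k::{real_normed_field,banach} dpoly"
  assumes "g \<in> dpolys \<Omega>" "\<And>k. P k \<in> dpolys \<Omega>"
  shows "vector_field \<Omega> g P \<in> derivations \<Omega>"
  unfolding derivations_def vector_field_def
  by (intro CollectI conjI ballI allI impI)
     (use assms in \<open>simp_all add: pderiv_u_add pderiv_u_mult pderiv_u_scale vertical_add vertical_mult
        vertical_scale scale_poly_axioms scale_poly_mult algebra_simps\<close>)

lemma vector_field_coef:
  assumes "h \<in> analytic_functions \<Omega>"
  shows "vector_field \<Omega> g P (Poly_Mapping.single 0 h) = g * Poly_Mapping.single 0 (deriv_on \<Omega> h)"
  using assms by (simp add: vector_field_def)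

lemma vector_field_var:
  fixes g :: "'k::{real_normed_field,banach} dpoly"
  assumes "P k \<in> dpolys \<Omega>"
  shows "vector_field \<Omega> g P (var_poly \<Omega> k) = P k"
  using assms by (simp add: vector_field_def vertical_var)

definition D_field :: "'k::{real_normed_field,banach} vfield" where
  "D_field = vector_field \<Omega> (var_poly \<Omega> 0) (\<lambda>k. var_poly \<Omega> (Suc k))"

lemma D_field_derivation: "(D_field :: 'k::{real_normed_field,banach} vfield) \<in> derivations \<Omega>"
  unfolding D_field_def by (rule vector_field_derivation) simp_all

lemma total_D_eq: "p \<in> dpolys \<Omega> \<Longrightarrow> total_D \<Omega> p = D_field p"
  by (simp add: D_field_def vector_field_def total_D_def vertical_def)

lemma total_D_funpow:
  fixes p :: "'k::{real_normed_field,banach} dpoly"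
  assumes "p \<in> dpolys \<Omega>"
  shows "(D_field ^^ n) p \<in> dpolys \<Omega> \<and> (total_D \<Omega> ^^ n) p = (D_field ^^ n) p"
  using assms by (induction n) (simp_all add: total_D_eq derivationsD(1)[OF D_field_derivation])

lemma X0_eq: "X0 \<Omega> = vector_field \<Omega> (coef_poly \<Omega> (\<lambda>_. 1 :: 'k::{real_normed_field,banach})) (\<lambda>_. 0)"
  by (auto simp: X0_def vector_field_def vertical_def fun_eq_iff)

lemma X1_eq: 
  assumes "coef_poly \<Omega> f \<in> dpolys \<Omega>"
  shows "X1 \<Omega> f = vector_field \<Omega> 0 (\<lambda>n. (D_field ^^ n) (coef_poly \<Omega> f) :: 'k::{real_normed_field,banach} dpoly)"
  using total_D_funpow[OF assms] by (auto simp: X1_def vector_field_def vertical_def fun_eq_iff)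

end

section \<open>A basis of the characteristic algebra\<close>

lemma cutoff_arith:
  "cutoff \<Omega> f * cutoff \<Omega> g = cutoff \<Omega> (\<lambda>u. f u * g u :: 'k::ring)"
  "cutoff \<Omega> f + cutoff \<Omega> g = cutoff \<Omega> (\<lambda>u. f u + g u :: 'k)"
  "- cutoff \<Omega> f = cutoff \<Omega> (\<lambda>u. - f u :: 'k)"
  "cutoff \<Omega> (\<lambda>_. 0 :: 'k) = 0"
  by (simp_all add: cutoff_def fun_eq_iff)

text \<open>
  The combinatorial data of the numbered root spaces: weights \<open>w\<close>, structure constants \<open>c\<close>, and the
  coefficients \<open>p\<close>, \<open>q\<close> with which the two negative generators lower the index by 1 and by 2.  The
  assumptions \<open>p_jacobi\<close> and \<open>q_jacobi\<close> are the Jacobi identity for one negative generator and two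
  positive root vectors; \<open>p_weight\<close> and \<open>q_weight\<close> say that lowering subtracts a simple root.  At
  \<open>i = 1\<close> the index \<open>i - 2\<close> is truncated to 0, which is harmless because \<open>q 1 = 0\<close>.
\<close>

locale char_basis = open_domain \<Omega> for \<Omega> :: "real set" +
  fixes \<alpha> \<beta> :: "'k::{real_normed_field,banach}"
    and w :: "nat \<Rightarrow> 'k" and p q :: "nat \<Rightarrow> 'k" and c :: "nat \<Rightarrow> nat \<Rightarrow> 'k"
  assumes w0: "w 0 = 0" and w1: "w 1 = \<alpha>" and w2: "w 2 = \<beta>"
    and p1: "p 1 = 1" and q1: "q 1 = 0" and p2: "p 2 = 0" and q2: "q 2 = 1"
    and p_weight: "\<And>i. 0 < i \<Longrightarrow> p i * (\<alpha> + w (i - 1)) = p i * w i"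
    and q_weight: "\<And>i. 0 < i \<Longrightarrow> q i * (\<beta> + w (i - 2)) = q i * w i"
    and c_0_left: "\<And>i. c 0 i = w i" and c_0_right: "\<And>i. c i 0 = - w i" and c11: "c 1 1 = 0"
    and p_jacobi: "\<And>i j. 0 < i \<Longrightarrow> 0 < j \<Longrightarrow> p i * c (i - 1) j + p j * c i (j - 1) = c i j * p (i + j)"
    and q_jacobi: "\<And>i j. 0 < i \<Longrightarrow> 0 < j \<Longrightarrow> q i * c (i - 2) j + q j * c i (j - 2) = c i j * q (i + j)"
begin

abbreviation K :: "'k \<Rightarrow> 'k dpoly" where "K a \<equiv> coef_poly \<Omega> (\<lambda>_. a)"

abbreviation E :: "'k \<Rightarrow> 'k dpoly" where "E a \<equiv> Poly_Mapping.single 0 (exp_fun \<Omega> a)"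

lemma K_mult: "K a * K b = K (a * b)"
  by (simp add: coef_poly_def mult_single cutoff_arith)

lemma K_add: "K a + K b = K (a + b)"
  by (simp add: coef_poly_def cutoff_arith flip: single_add)

lemma K_uminus: "K (- a) = - K a"
  by (simp add: coef_poly_def cutoff_arith flip: single_uminus)

lemma K_0 [simp]: "K 0 = 0"
  by (simp add: coef_poly_def cutoff_arith)

lemma derivation_K:
  assumes "X \<in> derivations \<Omega>" "r \<in> dpolys \<Omega>"
  shows "X (K a * r) = K a * X r"
  using derivationsD(4)[OF assms, of a] assms
  by (simp add: scale_poly_eq_mult derivationsD(1))

text \<open>
  \<open>coeff n i\<close> is the value of \<open>\<phi>\<^sub>i\<close> on \<open>u\<^bsub>n+1\<^esub>\<close>.  The recursion is what the relation for \<open>[\<phi>\<^sub>i, D]\<close> forces,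
  as \<open>\<phi>\<^sub>i (u\<^bsub>n+2\<^esub>) = \<phi>\<^sub>i (D u\<^bsub>n+1\<^esub>)\<close>; the starting values come from \<open>\<phi>\<^sub>i (D u)\<close>, where only \<open>\<phi>\<^sub>0\<close> acts on
  \<open>u\<close> itself.
\<close>

primrec coeff :: "nat \<Rightarrow> nat \<Rightarrow> 'k dpoly" where
  "coeff 0 = (\<lambda>i. if i = 1 then E \<alpha> else if i = 2 then E \<beta> else 0)"
| "coeff (Suc n) = (\<lambda>i. if i = 0 then 0 else
      D_field (coeff n i) + K (p i) * (E \<alpha> * coeff n (i - 1)) + K (q i) * (E \<beta> * coeff n (i - 2)))"

definition \<phi> :: "nat \<Rightarrow> 'k vfield" where
  "\<phi> i = vector_field \<Omega> (if i = 0 then K 1 else 0) (\<lambda>n. coeff n i)"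

lemma coeff_dpolys [simp]: "coeff n i \<in> dpolys \<Omega>"
  by (induction n arbitrary: i) (simp_all add: derivationsD(1)[OF D_field_derivation])

lemma coeff_0 [simp]: "coeff n 0 = 0"
  by (cases n) simp_all

lemma \<phi>_derivation [simp]: "\<phi> i \<in> derivations \<Omega>"
  unfolding \<phi>_def by (rule vector_field_derivation) simp_all

lemmas \<phi>D = derivationsD[OF \<phi>_derivation] derivation_zero[OF \<phi>_derivation] derivation_K[OF \<phi>_derivation]
lemmas DD = derivationsD[OF D_field_derivation] derivation_zero[OF D_field_derivation] derivation_K[OF D_field_derivation]

lemma \<phi>_coef:
  assumes "g \<in> analytic_functions \<Omega>"
  shows "\<phi> i (Poly_Mapping.single 0 g) = (if i = 0 then Poly_Mapping.single 0 (deriv_on \<Omega> g) else 0)"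
  using assms by (simp add: \<phi>_def vector_field_coef analytic_deriv)

lemma \<phi>_var [simp]: "\<phi> i (var_poly \<Omega> n) = coeff n i"
  by (simp add: \<phi>_def vector_field_var)

lemma D_coef: "g \<in> analytic_functions \<Omega> \<Longrightarrow>
    D_field (Poly_Mapping.single 0 g) = var_poly \<Omega> 0 * Poly_Mapping.single 0 (deriv_on \<Omega> g)"
  by (simp add: D_field_def vector_field_coef)

lemma D_var: "D_field (var_poly \<Omega> n) = (var_poly \<Omega> (Suc n) :: 'k dpoly)"
  by (simp add: D_field_def vector_field_var)

lemma \<phi>_0: "\<phi> 0 = X0 \<Omega>"
  by (simp add: \<phi>_def X0_eq)

lemma \<phi>_exp: "\<phi> i (E a) = (if i = 0 then K a * E a else 0)"
  by (simp add: \<phi>_coef deriv_on_exp coef_poly_def mult_single)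

text \<open>
  Both sides of \<open>[\<phi>\<^sub>i, D] = \<dots>\<close> are derivations.  On the variables they agree by the recursion for the
  coefficients, on functions of \<open>u\<close> by its starting values.
\<close>

lemma \<phi>_D:
  assumes r: "r \<in> dpolys \<Omega>" and i: "i > 0"
  shows "\<phi> i (D_field r) = D_field (\<phi> i r) + K (p i) * (E \<alpha> * \<phi> (i - 1) r) + K (q i) * (E \<beta> * \<phi> (i - 2) r)"
proof -
  have ba: "b - a = c \<longleftrightarrow> b = a + c" for a b c :: "'k dpoly" by (auto simp: algebra_simps)
  have "bracket (\<phi> i) D_field = (\<lambda>r. K (p i) * (E \<alpha> * \<phi> (i - 1) r) + K (q i) * (E \<beta> * \<phi> (i - 2) r))"
  proof (rule derivation_eqI)
    show "bracket (\<phi> i) D_field \<in> derivations \<Omega>"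
      by (intro derivations_bracket D_field_derivation \<phi>_derivation)
    show "(\<lambda>r. K (p i) * (E \<alpha> * \<phi> (i - 1) r) + K (q i) * (E \<beta> * \<phi> (i - 2) r)) \<in> derivations \<Omega>"
      by (intro derivations_add derivations_mult \<phi>_derivation) simp_all
  next
    fix g assume g: "g \<in> (analytic_functions \<Omega> :: (real \<Rightarrow> 'k) set)"
    have "i = 1 \<or> i = 2 \<or> i > 2" using i by linarith
    then show "bracket (\<phi> i) D_field (Poly_Mapping.single 0 g) =
        K (p i) * (E \<alpha> * \<phi> (i - 1) (Poly_Mapping.single 0 g)) + K (q i) * (E \<beta> * \<phi> (i - 2) (Poly_Mapping.single 0 g))"
      using i g p1 q1 p2 q2
      by (auto simp: bracket_def D_coef \<phi>_coef \<phi>D(5) \<phi>D(6) DD(6) analytic_deriv)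
  next
    fix k
    show "bracket (\<phi> i) D_field (var_poly \<Omega> k) =
        K (p i) * (E \<alpha> * \<phi> (i - 1) (var_poly \<Omega> k)) + K (q i) * (E \<beta> * \<phi> (i - 2) (var_poly \<Omega> k))"
      using i by (simp add: bracket_def D_var)
  qed
  then show ?thesis
    by (simp add: bracket_def fun_eq_iff ba add.assoc)
qed

lemma \<phi>_0_D:
  assumes r: "r \<in> dpolys \<Omega>"
  shows "\<phi> 0 (D_field r) = D_field (\<phi> 0 r)"
proof -
  have "bracket (\<phi> 0) D_field = (\<lambda>_. 0)"
  proof (rule derivation_eqI)
    show "bracket (\<phi> 0) D_field \<in> derivations \<Omega>"
      by (intro derivations_bracket D_field_derivation \<phi>_derivation)
    fix g assume g: "g \<in> (analytic_functions \<Omega> :: (real \<Rightarrow> 'k) set)"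
    show "bracket (\<phi> 0) D_field (Poly_Mapping.single 0 g) = 0"
      using g by (simp add: bracket_def D_coef \<phi>_coef \<phi>D(5) analytic_deriv)
  qed (simp_all add: bracket_def D_var DD(6) derivations_0)
  then show ?thesis
    by (simp add: bracket_def fun_eq_iff)
qed

lemma K_weight_cong:
  assumes "x * a = x * b" shows "K x * (K a * r) = K b * (K x * r)"
proof -
  have "K x * (K a * r) = K (x * a) * r" "K b * (K x * r) = K (b * x) * r"
    by (simp_all only: K_mult flip: mult.assoc)
  then show ?thesis using assms by (metis mult.commute)
qed

text \<open>
  \<open>X\<^sub>0\<close> commutes with \<open>D\<close> and multiplies \<open>e\<^sup>\<alpha>\<^sup>u\<close> by \<open>\<alpha>\<close>, so it passes through the recursion and collects
  weights.
\<close>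

lemma \<phi>_0_coeff: "\<phi> 0 (coeff n j) = K (w j) * coeff n j"
proof (induction n arbitrary: j)
  case 0
  then show ?case
    using w1 w2 by (auto simp: \<phi>_exp \<phi>D(6))
next
  case (Suc n)
  show ?case
  proof (cases "j = 0")
    case False
    then have j: "j > 0" by simp
    have "\<phi> 0 (E \<alpha> * coeff n i) = K (\<alpha> + w i) * (E \<alpha> * coeff n i)" for i
      by (simp add: \<phi>D(5) \<phi>_exp Suc algebra_simps flip: K_add)
    moreover have "\<phi> 0 (E \<beta> * coeff n i) = K (\<beta> + w i) * (E \<beta> * coeff n i)" for i
      by (simp add: \<phi>D(5) \<phi>_exp Suc algebra_simps flip: K_add)
    ultimately have "\<phi> 0 (coeff (Suc n) j) = D_field (K (w j) * coeff n j)
        + K (p j) * (K (\<alpha> + w (j - 1)) * (E \<alpha> * coeff n (j - 1)))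
        + K (q j) * (K (\<beta> + w (j - 2)) * (E \<beta> * coeff n (j - 2)))"
      using j by (simp add: \<phi>D(3) \<phi>D(7) \<phi>_0_D Suc DD(1))
    then show ?thesis
      using j by (simp add: K_weight_cong[OF p_weight[OF j, unfolded One_nat_def]] K_weight_cong[OF q_weight[OF j]] DD(7) distrib_left)
  qed (simp add: \<phi>D(6))
qed

lemma \<phi>_mult_exp: "r \<in> dpolys \<Omega> \<Longrightarrow> i > 0 \<Longrightarrow> \<phi> i (E a * r) = E a * \<phi> i r"
  by (simp add: \<phi>D(5) \<phi>_exp)

text \<open>
  Let \<open>R a b\<close> be the coefficient of \<open>[\<phi>\<^sub>a, \<phi>\<^sub>b]\<close> at one variable.  Commuting with \<open>D\<close> expresses the
  coefficient at the next variable through \<open>D (R i j)\<close> and the values of \<open>R\<close> with one index lowered; the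
  Jacobi identities then recombine these into the recursion for \<open>\<phi>\<^bsub>i+j\<^esub>\<close>.  Pairs containing the index 0
  are treated apart, since \<open>\<phi>\<^sub>0\<close> alone acts on the factors \<open>e\<^sup>\<alpha>\<^sup>u\<close> and \<open>e\<^sup>\<beta>\<^sup>u\<close>.
\<close>

lemma \<phi>_bracket_coeff: "\<phi> i (coeff n j) - \<phi> j (coeff n i) = K (c i j) * coeff n (i + j)"
proof (induction n arbitrary: i j)
  case 0
  show ?case
  proof (cases "i = 0 \<or> j = 0")
    case True
    then show ?thesis
      using \<phi>_0_coeff[of 0] by (auto simp: c_0_left c_0_right K_uminus \<phi>D(6) simp del: coeff.simps)
  next
    case False
    then have "i + j = 2 \<longleftrightarrow> i = 1 \<and> j = 1" by auto
    then show ?thesis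
      using False c11 by (auto simp: \<phi>_exp \<phi>D(6))
  qed
next
  case (Suc n)
  show ?case
  proof (cases "i = 0 \<or> j = 0")
    case True
    then show ?thesis
      using \<phi>_0_coeff[of "Suc n"] by (auto simp: c_0_left c_0_right K_uminus \<phi>D(6) simp del: coeff.simps)
  next
    case False
    then have i: "i > 0" and j: "j > 0" by auto
    define R where "R a b = \<phi> a (coeff n b) - \<phi> b (coeff n a)" for a b
    have R: "R a b = K (c a b) * coeff n (a + b)" for a b
      unfolding R_def by (rule Suc)
    have DR: "D_field (R i j) = D_field (\<phi> i (coeff n j)) - D_field (\<phi> j (coeff n i))"
      unfolding R_def by (intro derivation_diff D_field_derivation \<phi>D(1)) simp_all
    have step: "\<phi> a (coeff (Suc n) b) = D_field (\<phi> a (coeff n b))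
        + K (p a) * (E \<alpha> * \<phi> (a - 1) (coeff n b)) + K (q a) * (E \<beta> * \<phi> (a - 2) (coeff n b))
        + K (p b) * (E \<alpha> * \<phi> a (coeff n (b - 1))) + K (q b) * (E \<beta> * \<phi> a (coeff n (b - 2)))"
      if "a > 0" "b > 0" for a b
      using that by (simp add: \<phi>D(3) \<phi>D(7) \<phi>_D \<phi>_mult_exp DD(1))
    have "\<phi> i (coeff (Suc n) j) - \<phi> j (coeff (Suc n) i) = D_field (R i j)
        + E \<alpha> * (K (p i) * R (i - 1) j + K (p j) * R i (j - 1))
        + E \<beta> * (K (q i) * R (i - 2) j + K (q j) * R i (j - 2))"
      unfolding step[OF i j] step[OF j i] DR unfolding R_def by (simp add: algebra_simps)
    also have "K (p i) * R (i - 1) j + K (p j) * R i (j - 1) = K (c i j * p (i + j)) * coeff n (i + j - 1)"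
      using i j by (simp add: R p_jacobi[OF i j, symmetric] K_mult distrib_right flip: K_add mult.assoc)
    also have "K (q i) * R (i - 2) j + K (q j) * R i (j - 2) = K (c i j * q (i + j)) * coeff n (i + j - 2)"
    proof -
      have "K (q i) * R (i - 2) j = K (q i * c (i - 2) j) * coeff n (i + j - 2)"
        using i q1 by (cases "i = 1") (simp_all add: R K_mult flip: mult.assoc)
      moreover have "K (q j) * R i (j - 2) = K (q j * c i (j - 2)) * coeff n (i + j - 2)"
        using j q1 by (cases "j = 1") (simp_all add: R K_mult flip: mult.assoc)
      ultimately show ?thesis
        by (simp add: q_jacobi[OF i j, symmetric] distrib_right flip: K_add)
    qed
    also have "D_field (R i j) = K (c i j) * D_field (coeff n (i + j))"
      by (simp add: R DD(7))
    finally show ?thesis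
      using i j by (simp add: distrib_left mult_ac flip: K_mult)
  qed
qed

lemma bracket_\<phi>: "bracket (\<phi> i) (\<phi> j) = scale_vf (c i j) (\<phi> (i + j))"
proof (rule derivation_eqI)
  show "bracket (\<phi> i) (\<phi> j) \<in> derivations \<Omega>"
    by (intro derivations_bracket \<phi>_derivation)
  show "scale_vf (c i j) (\<phi> (i + j)) \<in> derivations \<Omega>"
    by (intro derivations_scale \<phi>_derivation)
  fix g assume g: "g \<in> (analytic_functions \<Omega> :: (real \<Rightarrow> 'k) set)"
  show "bracket (\<phi> i) (\<phi> j) (Poly_Mapping.single 0 g) = scale_vf (c i j) (\<phi> (i + j)) (Poly_Mapping.single 0 g)"
    using g w0 c_0_left[of 0]
    by (auto simp: bracket_def scale_vf_def \<phi>_coef \<phi>D(6) analytic_deriv scale_poly_eq_mult)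
next
  fix k
  show "bracket (\<phi> i) (\<phi> j) (var_poly \<Omega> k) = scale_vf (c i j) (\<phi> (i + j)) (var_poly \<Omega> k)"
    by (simp add: bracket_def scale_vf_def \<phi>_bracket_coeff scale_poly_eq_mult)
qed

lemma coeff_1: "coeff n 1 = (D_field ^^ n) (E \<alpha>)"
  by (induction n) (use p1 q1 in simp_all)

lemma coeff_2: "coeff n 2 = (D_field ^^ n) (E \<beta>)"
  by (induction n) (use p2 q2 in simp_all)

lemma D_funpow_comb:
  "(D_field ^^ n) (K a * E \<alpha> + K b * E \<beta>) = K a * coeff n 1 + K b * coeff n 2"
proof -
  have dp: "(D_field ^^ n) (E \<alpha>) \<in> dpolys \<Omega>" "(D_field ^^ n) (E \<beta>) \<in> dpolys \<Omega>" for n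
    using coeff_dpolys[of n 1] coeff_dpolys[of n 2] unfolding coeff_1 coeff_2 by simp_all
  show ?thesis
    unfolding coeff_1 coeff_2 by (induction n) (simp_all add: DD(3) DD(7) dp)
qed

text \<open>
  For \<open>i = 1\<close> and \<open>i = 2\<close> the recursion degenerates to repeated application of \<open>D\<close>, so \<open>\<phi>\<^sub>1\<close> and \<open>\<phi>\<^sub>2\<close> are
  the fields \<open>X(e\<^sup>\<alpha>\<^sup>u)\<close> and \<open>X(e\<^sup>\<beta>\<^sup>u)\<close>.
\<close>

lemma X1_comb:
  "X1 \<Omega> (\<lambda>u. a * exp (\<alpha> * of_real u) + b * exp (\<beta> * of_real u)) =
     scale_vf a (\<phi> 1) + scale_vf b (\<phi> 2)"
proof -
  have eq: "coef_poly \<Omega> (\<lambda>u. a * exp (\<alpha> * of_real u) + b * exp (\<beta> * of_real u)) = K a * E \<alpha> + K b * E \<beta>"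
    by (simp add: coef_poly_def mult_single exp_fun_def cutoff_arith flip: single_add)
  have dp: "coef_poly \<Omega> (\<lambda>u. a * exp (\<alpha> * of_real u) + b * exp (\<beta> * of_real u)) \<in> dpolys \<Omega>"
    unfolding eq by simp
  show ?thesis
    unfolding X1_eq[OF dp] unfolding eq
  proof (rule derivation_eqI)
    show "vector_field \<Omega> 0 (\<lambda>n. (D_field ^^ n) (K a * E \<alpha> + K b * E \<beta>)) \<in> derivations \<Omega>"
      by (rule vector_field_derivation) (simp_all add: D_funpow_comb)
    show "scale_vf a (\<phi> 1) + scale_vf b (\<phi> 2) \<in> derivations \<Omega>"
      using derivations_add[OF derivations_scale[OF \<phi>_derivation] derivations_scale[OF \<phi>_derivation]]
      by (simp add: plus_fun_def)
  qed (simp_all add: scale_vf_def vector_field_var D_funpow_comb vector_field_coef \<phi>_coef scale_poly_eq_mult)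
qed

end

section \<open>Growth\<close>

context open_domain
begin

lemma bracket_add_right:
  fixes X Y Z :: "'k::{real_normed_field,banach} vfield"
  assumes X: "X \<in> derivations \<Omega>" and Y: "Y \<in> derivations \<Omega>" and Z: "Z \<in> derivations \<Omega>"
  shows "bracket X (Y + Z) = bracket X Y + bracket X Z"
proof
  fix p
  show "bracket X (Y + Z) p = (bracket X Y + bracket X Z) p"
    by (cases "p \<in> dpolys \<Omega>")
      (simp_all add: bracket_def derivationsD(1,2,3)[OF X] derivationsD(1,2)[OF Y] derivationsD(1,2)[OF Z]
        derivation_zero[OF X] derivation_zero[OF Y] derivation_zero[OF Z])
qed

lemma bracket_scale_right:
  fixes X Y :: "'k::{real_normed_field,banach} vfield"
  assumes X: "X \<in> derivations \<Omega>" and Y: "Y \<in> derivations \<Omega>"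
  shows "bracket X (scale_vf a Y) = scale_vf a (bracket X Y)"
proof
  fix p
  show "bracket X (scale_vf a Y) p = scale_vf a (bracket X Y) p"
    by (cases "p \<in> dpolys \<Omega>")
      (simp_all add: bracket_def scale_vf_def scale_poly_diff derivationsD(1,2,4)[OF X] derivationsD(1,2)[OF Y]
        derivation_zero[OF X] derivation_zero[OF Y])
qed

lemma bracket_commute: "bracket X Y = scale_vf (- 1) (bracket Y X)"
  by (simp add: vf.scale_minus_left) (simp add: bracket_def fun_eq_iff)

lemma subspace_derivations: "vf.subspace (derivations \<Omega> :: 'k::{real_normed_field,banach} vfield set)"
  using lie_subalgebra_derivations[where 'k = 'k] by (simp add: lie_subalgebra_def)

lemma bracket_zero_right:
  fixes X :: "'k::{real_normed_field,banach} vfield"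
  assumes X: "X \<in> derivations \<Omega>"
  shows "bracket X 0 = 0"
  using derivation_zero[OF X] by (simp add: bracket_def fun_eq_iff)

lemma bracket_span_right:
  fixes X :: "'k::{real_normed_field,banach} vfield"
  assumes X: "X \<in> derivations \<Omega>" and B: "B \<subseteq> derivations \<Omega>" and W: "vf.subspace W"
    and b: "\<And>Y. Y \<in> B \<Longrightarrow> bracket X Y \<in> W" and Y: "Y \<in> vf.span B"
  shows "bracket X Y \<in> W"
proof -
  have "Y \<in> derivations \<Omega> \<and> bracket X Y \<in> W"
    using Y
  proof (induction rule: vf.span_induct_alt)
    case base
    show ?case unfolding bracket_zero_right[OF X]
      using vf.subspace_0[OF W] vf.subspace_0[OF subspace_derivations] by blast
  next
    case (step a Y Z)
    have d: "Y \<in> derivations \<Omega>" "scale_vf a Y \<in> derivations \<Omega>" "Z \<in> derivations \<Omega>"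
      using step B by (auto intro: derivations_scale)
    have "scale_vf a (bracket X Y) + bracket X Z \<in> W"
      using step b by (intro vf.subspace_add[OF W] vf.subspace_scale[OF W]) auto
    then show ?case
      unfolding bracket_add_right[OF X d(2,3)] bracket_scale_right[OF X d(1)]
      using vf.subspace_add[OF subspace_derivations d(2,3)] by (intro conjI)
  qed
  then show ?thesis by simp
qed

lemma bracket_span:
  fixes A B :: "'k::{real_normed_field,banach} vfield set"
  assumes A: "A \<subseteq> derivations \<Omega>" and B: "B \<subseteq> derivations \<Omega>" and W: "vf.subspace W"
    and ab: "\<And>X Y. X \<in> A \<Longrightarrow> Y \<in> B \<Longrightarrow> bracket X Y \<in> W"
    and X: "X \<in> vf.span A" and Y: "Y \<in> vf.span B"
  shows "bracket X Y \<in> W"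
proof -
  have XD: "X \<in> derivations \<Omega>"
    using X vf.span_minimal[OF A subspace_derivations] by auto
  show ?thesis
  proof (rule bracket_span_right[OF XD B W _ Y])
    fix Z assume Z: "Z \<in> B"
    have "bracket Z X \<in> W"
    proof (rule bracket_span_right[OF _ A W _ X])
      fix T assume "T \<in> A"
      then show "bracket Z T \<in> W"
        by (subst bracket_commute) (intro vf.subspace_scale[OF W] ab Z)
    qed (use Z B in auto)
    then show "bracket X Z \<in> W"
      by (subst bracket_commute) (rule vf.subspace_scale[OF W])
  qed
qed

lemma lie_subalgebra_hull:
  fixes S :: "'k::{real_normed_field,banach} vfield set"
  assumes "S \<subseteq> derivations \<Omega>"
  shows "lie_subalgebra \<Omega> (lie_subalgebra \<Omega> hull S)"
proof -
  define H where "H = lie_subalgebra \<Omega> hull S"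
  have "H \<subseteq> derivations \<Omega>"
    unfolding H_def using assms lie_subalgebra_derivations by (rule hull_minimal)
  moreover have "vf.subspace H"
    unfolding H_def hull_def by (rule vf.subspace_Inter) (simp add: lie_subalgebra_def)
  moreover have "bracket X Y \<in> H" if XY: "X \<in> H" "Y \<in> H" for X Y
    unfolding H_def hull_def
  proof (rule InterI)
    fix T assume "T \<in> {T. lie_subalgebra \<Omega> T \<and> S \<subseteq> T}"
    then have T: "lie_subalgebra \<Omega> T" "S \<subseteq> T" by auto
    then have "X \<in> T" "Y \<in> T" using XY by (auto simp: H_def hull_def)
    with T(1) show "bracket X Y \<in> T" by (simp add: lie_subalgebra_def)
  qed
  ultimately have "lie_subalgebra \<Omega> H" by (simp add: lie_subalgebra_def)
  then show ?thesis unfolding H_def .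
qed

end

lemma sum_vfield_apply:
  "(\<Sum>i\<in>S. scale_vf (a i) (X i)) p = (\<Sum>i\<in>S. scale_poly (a i) (X i p))"
  by (induction S rule: infinite_finite_induct) (simp_all add: scale_vf_def)

lemma sum_scale_remove:
  assumes "finite S" "a j = 0"
  shows "(\<Sum>i\<in>S - {j}. scale_vf (a i) (X i)) = (\<Sum>i\<in>S. scale_vf (a i) (X i))"
proof (rule sum.mono_neutral_left)
  show "\<forall>i\<in>S - (S - {j}). scale_vf (a i) (X i) = 0"
    using assms(2) vf.scale_zero_left by fastforce
qed (use assms(1) in auto)

text \<open>
  \<open>deg\<close> is the principal grading, in which both generators have degree 1.  The last two
  assumptions say that \<open>deg i\<close> stays within a bounded distance of \<open>(L / M) i\<close>, so that \<open>M / L\<close> is the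
  average number of root vectors per degree.
\<close>

locale char_graded = char_basis \<Omega> \<alpha> \<beta> w p q c
  for \<Omega> and \<alpha> \<beta> :: "'k::{real_normed_field,banach}" and w p q c +
  fixes deg :: "nat \<Rightarrow> nat" and L M C :: nat
  assumes nonempty: "\<Omega> \<noteq> {}"
    and deg_0: "deg 0 = 0" and deg_1: "deg 1 = 1" and deg_2: "deg 2 = 1"
    and p_deg: "\<And>i. 0 < i \<Longrightarrow> p i \<noteq> 0 \<Longrightarrow> deg i = Suc (deg (i - 1))"
    and q_deg: "\<And>i. 0 < i \<Longrightarrow> q i \<noteq> 0 \<Longrightarrow> deg i = Suc (deg (i - 2))"
    and p_plus_q: "\<And>i. 0 < i \<Longrightarrow> p i + q i = 1"
    and deg_add: "\<And>i j. c i j \<noteq> 0 \<Longrightarrow> deg (i + j) \<le> deg i + deg j"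
    and generated: "\<And>i. 3 \<le> i \<Longrightarrow> c 1 (i - 1) \<noteq> 0 \<and> deg i = Suc (deg (i - 1)) \<or>
        c 2 (i - 2) \<noteq> 0 \<and> deg i = Suc (deg (i - 2))"
    and separated: "\<And>i j. deg i = deg j \<Longrightarrow> w i = w j \<Longrightarrow> i = j"
    and L_pos: "0 < L" and M_pos: "0 < M"
    and deg_lower: "\<And>i. L * i \<le> M * deg i + C" and deg_upper: "\<And>i. M * deg i \<le> L * i + C"
begin

lemma deg_pos: "0 < i \<Longrightarrow> 0 < deg i"
  using p_plus_q[of i] p_deg[of i] q_deg[of i] by (cases "p i = 0") auto

lemma deg_ge_2: "3 \<le> i \<Longrightarrow> 2 \<le> deg i"
  using generated[of i] deg_pos[of "i - 1"] deg_pos[of "i - 2"] by auto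

lemma E_mult: "E a * E b = E (a + b)"
  by (simp add: mult_single exp_fun_def cutoff_arith exp_add distrib_right)

text \<open>
  Every step of the recursion along \<open>p\<close> or \<open>q\<close> lowers the degree by one, and only degree 0 acts on
  \<open>u\<close>; hence \<open>\<phi>\<^sub>i\<close> annihilates the variables \<open>u\<^sub>k\<close> with \<open>k < deg i\<close>.
\<close>

lemma coeff_below: "Suc n < deg i \<Longrightarrow> coeff n i = 0"
proof (induction n arbitrary: i)
  case 0
  then show ?case using deg_1 deg_2 by auto
next
  case (Suc n)
  then have i: "i > 0" using deg_0 by (cases i) auto
  have "K (p i) * (E \<alpha> * coeff n (i - 1)) = 0"
    using Suc p_deg[OF i] by (cases "p i = 0") auto
  moreover have "K (q i) * (E \<beta> * coeff n (i - 2)) = 0"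
    using Suc q_deg[OF i] by (cases "q i = 0") auto
  ultimately show ?case using Suc i by (simp add: DD(6))
qed

text \<open>
  At the first position where \<open>\<phi>\<^sub>i\<close> does not vanish, the term with \<open>D\<close> drops out, and the two remaining
  terms are \<open>p\<^sub>i\<close> and \<open>q\<^sub>i\<close> times the same exponential.  This is the reason for scaling the basis so that
  \<open>p\<^sub>i + q\<^sub>i = 1\<close>.
\<close>

lemma coeff_leading: "0 < i \<Longrightarrow> deg i = Suc n \<Longrightarrow> coeff n i = E (w i)"
proof (induction n arbitrary: i)
  case 0
  then have "\<not> 3 \<le> i" using deg_ge_2[of i] by auto
  with 0 have "i = 1 \<or> i = 2" by linarith
  then show ?case using w1 w2 by auto
next
  case (Suc n)
  have i3: "3 \<le> i"
  proof (rule ccontr)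
    assume "\<not> 3 \<le> i"
    with Suc.prems(1) have "i = 1 \<or> i = 2" by linarith
    then show False using Suc.prems(2) deg_1 deg_2 by auto
  qed
  have 1: "K (p i) * (E \<alpha> * coeff n (i - 1)) = K (p i) * E (w i)"
  proof (cases "p i = 0")
    case False
    then have "\<alpha> + w (i - 1) = w i" using p_weight[of i] i3 by simp
    moreover have "coeff n (i - 1) = E (w (i - 1))"
      using False Suc.prems p_deg[of i] i3 by (intro Suc.IH) auto
    ultimately show ?thesis by (simp only: E_mult)
  qed simp
  have 2: "K (q i) * (E \<beta> * coeff n (i - 2)) = K (q i) * E (w i)"
  proof (cases "q i = 0")
    case False
    then have "\<beta> + w (i - 2) = w i" using q_weight[of i] i3 by simp
    moreover have "coeff n (i - 2) = E (w (i - 2))"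
      using False Suc.prems q_deg[of i] i3 by (intro Suc.IH) auto
    ultimately show ?thesis by (simp only: E_mult)
  qed simp
  have "coeff (Suc n) i = D_field (coeff n i) + K (p i) * (E \<alpha> * coeff n (i - 1)) + K (q i) * (E \<beta> * coeff n (i - 2))"
    using i3 by simp
  also have "\<dots> = K (p i + q i) * E (w i)"
    unfolding 1 2 using coeff_below[of n i] Suc.prems by (simp add: DD(6) distrib_right flip: K_add)
  finally show ?case using p_plus_q[of i] i3 by simp
qed

lemma scale_E_eq_0: "scale_poly a (E b) = 0 \<Longrightarrow> a = 0"
proof -
  assume "scale_poly a (E b) = 0"
  then have "Poly_Mapping.lookup (scale_poly a (E b)) 0 = 0" by simp
  then have *: "(\<lambda>_. a) * exp_fun \<Omega> b = 0"
    by (simp add: scale_poly_def mult_single)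
  obtain u where "u \<in> \<Omega>" using nonempty by auto
  then show "a = 0" using fun_cong[OF *, of u] by (simp add: exp_fun_def cutoff_def)
qed

lemma bracket_\<phi>_0_sum:
  "finite S \<Longrightarrow> bracket (\<phi> 0) (\<Sum>i\<in>S. scale_vf (a i) (\<phi> i)) = (\<Sum>i\<in>S. scale_vf (w i * a i) (\<phi> i))"
proof (induction S rule: finite_induct)
  case empty
  show ?case unfolding sum.empty by (rule bracket_zero_right[OF \<phi>_derivation])
next
  case (insert i S)
  have "(\<Sum>i\<in>S. scale_vf (a i) (\<phi> i)) \<in> derivations \<Omega>"
    by (intro vf.subspace_sum[OF subspace_derivations] derivations_scale \<phi>_derivation)
  then have "bracket (\<phi> 0) (scale_vf (a i) (\<phi> i) + (\<Sum>i\<in>S. scale_vf (a i) (\<phi> i)))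
      = scale_vf (a i) (bracket (\<phi> 0) (\<phi> i)) + bracket (\<phi> 0) (\<Sum>i\<in>S. scale_vf (a i) (\<phi> i))"
    by (simp only: bracket_add_right bracket_scale_right derivations_scale \<phi>_derivation)
  also have "scale_vf (a i) (bracket (\<phi> 0) (\<phi> i)) = scale_vf (w i * a i) (\<phi> i)"
    by (simp add: bracket_\<phi> c_0_left mult.commute)
  finally show ?case
    unfolding sum.insert[OF insert.hyps] insert.IH .
qed

text \<open>
  Among fields of equal weight the degrees differ, so a variable \<open>u\<^sub>k\<close> with \<open>k\<close> the smallest degree
  detects exactly one of them.  If that degree is 0, the field is \<open>X\<^sub>0\<close> and is detected by \<open>e\<^sup>u\<close>.
\<close>

lemma leading_independent:
  assumes S: "finite S" and sum: "(\<Sum>i\<in>S. scale_vf (a i) (\<phi> i)) = 0"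
    and w: "\<And>i j. i \<in> S \<Longrightarrow> j \<in> S \<Longrightarrow> w i = w j" and ne: "S \<noteq> {}"
  shows "\<exists>i\<in>S. a i = 0"
proof -
  obtain i where i: "i \<in> S" "\<And>j. j \<in> S \<Longrightarrow> deg i \<le> deg j"
    using ex_min_if_finite[of "deg ` S"] S ne by (metis finite_imageI image_iff image_is_empty linorder_not_less)
  have less: "deg i < deg j" if "j \<in> S" "j \<noteq> i" for j
    using i(2)[OF that(1)] separated[of i j] w[OF i(1) that(1)] that(2) by (metis order_le_less)
  have single: "a i = 0" if "\<phi> i r = E b" "\<And>j. j \<in> S \<Longrightarrow> j \<noteq> i \<Longrightarrow> \<phi> j r = 0" for r b
  proof -
    have "0 = (\<Sum>j\<in>S. scale_poly (a j) (\<phi> j r))"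
      using fun_cong[OF sum, of r] by (simp add: sum_vfield_apply)
    also have "\<dots> = scale_poly (a i) (E b) + (\<Sum>j\<in>S - {i}. scale_poly (a j) (\<phi> j r))"
      using S i(1) that(1) by (simp add: sum.remove)
    also have "(\<Sum>j\<in>S - {i}. scale_poly (a j) (\<phi> j r)) = 0"
      using that(2) by (intro sum.neutral) auto
    finally show ?thesis by (simp add: scale_E_eq_0)
  qed
  have "a i = 0"
  proof (cases "i = 0")
    case True
    show ?thesis
    proof (rule single)
      show "\<phi> i (E 1) = E 1" using True by (simp add: \<phi>_exp)
      show "\<phi> j (E 1) = 0" if "j \<in> S" "j \<noteq> i" for j using that True by (simp add: \<phi>_exp)
    qed
  next
    case False
    then obtain n where n: "deg i = Suc n" using deg_pos[of i] by (cases "deg i") auto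
    show ?thesis
    proof (rule single)
      show "\<phi> i (var_poly \<Omega> n) = E (w i)" using coeff_leading False n by simp
      show "\<phi> j (var_poly \<Omega> n) = 0" if "j \<in> S" "j \<noteq> i" for j
        using coeff_below[of n j] less[OF that] n by simp
    qed
  qed
  with i(1) show ?thesis by blast
qed

text \<open>
  In a shortest nontrivial relation all weights agree: otherwise \<open>ad X\<^sub>0 - w\<^sub>k\<close> turns it into a shorter
  one.  So the case of equal weights suffices.
\<close>

lemma \<phi>_independent:
  assumes "finite S" "(\<Sum>i\<in>S. scale_vf (a i) (\<phi> i)) = 0" "i \<in> S"
  shows "a i = 0"
  using assms
proof (induction S arbitrary: a i rule: finite_psubset_induct)
  case (psubset S)
  show ?case
  proof (rule ccontr)
    assume ai: "a i \<noteq> 0"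
    show False
    proof (cases "\<exists>j\<in>S. a j = 0")
      case True
      then obtain j where j: "j \<in> S" "a j = 0" by blast
      have "(\<Sum>i\<in>S - {j}. scale_vf (a i) (\<phi> i)) = 0"
        using psubset.prems(1) unfolding sum_scale_remove[where a = a and j = j, OF psubset.hyps j(2)] .
      then show False using psubset.IH[of "S - {j}" a i] ai j psubset.prems by auto
    next
      case False
      then obtain j k where jk: "j \<in> S" "k \<in> S" "w j \<noteq> w k"
        using leading_independent[OF psubset.hyps psubset.prems(1)] psubset.prems(2) by blast
      \<comment> \<open>applying \<open>ad X\<^sub>0 - w k\<close> to the relation kills the term \<open>k\<close> and keeps the term \<open>j\<close>\<close>
      have "(\<Sum>i\<in>S. scale_vf ((w i - w k) * a i) (\<phi> i)) =
          bracket (\<phi> 0) (\<Sum>i\<in>S. scale_vf (a i) (\<phi> i)) - scale_vf (w k) (\<Sum>i\<in>S. scale_vf (a i) (\<phi> i))"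
        by (simp only: bracket_\<phi>_0_sum[OF psubset.hyps] vf.scale_sum_right vf.scale_left_diff_distrib
            left_diff_distrib sum_subtractf vf.scale_scale)
      also have "\<dots> = 0"
        unfolding psubset.prems(1) bracket_zero_right[OF \<phi>_derivation] vf.scale_zero_right by (rule diff_self)
      finally have "(\<Sum>i\<in>S - {k}. scale_vf ((w i - w k) * a i) (\<phi> i)) = 0"
        using sum_scale_remove[where a = "\<lambda>i. (w i - w k) * a i" and j = k and X = \<phi>, OF psubset.hyps]
        by simp
      then have "(w j - w k) * a j = 0"
        using psubset.IH[of "S - {k}" "\<lambda>i. (w i - w k) * a i" j] jk by auto
      then show False using jk False by auto
    qed
  qed
qed

lemma inj_\<phi>: "inj \<phi>"
proof (rule injI, rule ccontr)
  fix i j assume eq: "\<phi> i = \<phi> j" and ne: "i \<noteq> j"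
  have "(\<Sum>k\<in>{i, j}. scale_vf (if k = i then 1 else - 1) (\<phi> k)) = 0"
    using ne eq by simp
  from \<phi>_independent[OF _ this, of i] show False by simp
qed

lemma independent_\<phi>: "vf.independent (\<phi> ` I)"
  unfolding vf.independent_explicit_finite_subsets
proof (intro allI impI ballI)
  fix S u v assume S: "S \<subseteq> \<phi> ` I" "finite S" and 0: "(\<Sum>v\<in>S. scale_vf (u v) v) = 0" and v: "v \<in> S"
  define T where "T = \<phi> -` S"
  have T: "S = \<phi> ` T" using S(1) by (auto simp: T_def)
  have fin: "finite T" unfolding T_def by (rule finite_vimageI[OF S(2) inj_\<phi>])
  have "(\<Sum>i\<in>T. scale_vf (u (\<phi> i)) (\<phi> i)) = 0"
    using 0 inj_\<phi> unfolding T by (simp add: sum.reindex inj_on_def)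
  from \<phi>_independent[OF fin this] show "u v = 0" using v T by auto
qed

definition V :: "'k vfield set" where "V = vf.span {\<phi> 0, \<phi> 1, \<phi> 2}"

lemma lie_product_in_span:
  "lie_product V m X \<Longrightarrow> X \<in> vf.span (\<phi> ` {i. deg i \<le> m})"
proof (induction rule: lie_product.induct)
  case (base X)
  have "{\<phi> 0, \<phi> 1, \<phi> 2} \<subseteq> \<phi> ` {i. deg i \<le> 1}" using deg_0 deg_1 deg_2 by auto
  then show ?case using base vf.span_mono unfolding V_def by blast
next
  case (step m X n Y)
  show ?case
  proof (rule bracket_span[OF _ _ vf.subspace_span _ step.IH])
    fix X Y assume "X \<in> \<phi> ` {i. deg i \<le> m}" "Y \<in> \<phi> ` {i. deg i \<le> n}"
    then obtain i j where ij: "X = \<phi> i" "Y = \<phi> j" "deg i \<le> m" "deg j \<le> n" by auto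
    show "bracket X Y \<in> vf.span (\<phi> ` {i. deg i \<le> m + n})"
    proof (cases "c i j = 0")
      case True
      then show ?thesis by (simp add: ij bracket_\<phi> vf.span_zero)
    next
      case False
      then have "deg (i + j) \<le> m + n" using deg_add[of i j] ij by linarith
      then show ?thesis unfolding ij bracket_\<phi> by (intro vf.span_scale vf.span_base) auto
    qed
  qed auto
qed

lemma V_base: "i \<le> 2 \<Longrightarrow> scale_vf a (\<phi> i) \<in> V"
  unfolding V_def by (intro vf.span_scale vf.span_base) (auto simp: le_Suc_eq numeral_2_eq_2)

text \<open>
  The maximum accounts for \<open>\<phi>\<^sub>0\<close>, which has degree 0 but length 1 as a product.
\<close>

lemma lie_product_\<phi>: "\<exists>s. s \<noteq> 0 \<and> lie_product V (max 1 (deg i)) (scale_vf s (\<phi> i))"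
proof (induction i rule: less_induct)
  case (less i)
  show ?case
  proof (cases "3 \<le> i")
    case False
    then have "i = 0 \<or> i = 1 \<or> i = 2" by linarith
    then have "max 1 (deg i) = 1" "scale_vf 1 (\<phi> i) \<in> V"
      using deg_0 deg_1 deg_2 V_base[of i 1] by auto
    then show ?thesis using lie_product.base[of "scale_vf 1 (\<phi> i)" V] by (intro exI[of _ 1]) simp
  next
    case True
    have step: ?thesis if k: "k \<in> {1, 2}" and ck: "c k (i - k) \<noteq> 0" and dk: "deg i = Suc (deg (i - k))" for k
    proof -
      have lt: "i - k < i" "0 < i - k" "k + (i - k) = i" using True k by auto
      then obtain s where s: "s \<noteq> 0" "lie_product V (deg (i - k)) (scale_vf s (\<phi> (i - k)))"
        using less.IH[of "i - k"] deg_pos[of "i - k"] by (auto simp: max_def Suc_le_eq split: if_splits)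
      have "scale_vf 1 (\<phi> k) \<in> V" using k by (intro V_base) auto
      then have "lie_product V 1 (\<phi> k)" by (intro lie_product.base) simp
      from lie_product.step[OF this s(2)]
      have "lie_product V (1 + deg (i - k)) (scale_vf (s * c k (i - k)) (\<phi> i))"
        by (simp add: bracket_scale_right bracket_\<phi> lt)
      then show ?thesis using s(1) ck dk by (intro exI[of _ "s * c k (i - k)"]) (simp add: max_def)
    qed
    show ?thesis using generated[OF True] step[of 1] step[of 2] by auto
  qed
qed

lemma lie_filtration_V:
  assumes "n > 0"
  shows "lie_filtration V n = vf.span (\<phi> ` {i. deg i \<le> n})"
  unfolding lie_filtration_def
proof (rule antisym; rule vf.span_minimal[OF _ vf.subspace_span]; rule subsetI)
  fix X assume "X \<in> {X. \<exists>m\<le>n. lie_product V m X}"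
  then obtain m where m: "m \<le> n" "lie_product V m X" by auto
  have "vf.span (\<phi> ` {i. deg i \<le> m}) \<subseteq> vf.span (\<phi> ` {i. deg i \<le> n})"
    using m(1) by (intro vf.span_mono) auto
  then show "X \<in> vf.span (\<phi> ` {i. deg i \<le> n})" using lie_product_in_span[OF m(2)] by auto
next
  fix X assume "X \<in> \<phi> ` {i. deg i \<le> n}"
  then obtain i where i: "X = \<phi> i" "deg i \<le> n" by auto
  obtain s where s: "s \<noteq> 0" "lie_product V (max 1 (deg i)) (scale_vf s (\<phi> i))"
    using lie_product_\<phi> by blast
  have "scale_vf s (\<phi> i) \<in> vf.span {X. \<exists>m\<le>n. lie_product V m X}"
    by (rule vf.span_base) (use s(2) i assms in \<open>auto intro!: exI[of _ "max 1 (deg i)"]\<close>)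
  from vf.span_scale[OF this, of "inverse s"] show "X \<in> vf.span {X. \<exists>m\<le>n. lie_product V m X}"
    using s(1) i by simp
qed

lemma growth_V:
  assumes "n > 0"
  shows "growth_function V n = card {i. deg i \<le> n}"
  unfolding growth_function_def lie_filtration_V[OF assms] vf.dim_span_eq_card_independent[OF independent_\<phi>]
  by (rule card_image) (use inj_\<phi> in \<open>auto simp: inj_on_def\<close>)

lemma growth_bound:
  assumes "n > 0"
  shows "\<bar>real (growth_function V n) / real n - M / L\<bar> \<le> (C / L + 1) * (1 / real n)"
proof -
  let ?F = "growth_function V n"
  have "{i. deg i \<le> n} \<subseteq> {..(M * n + C) div L}"
  proof (rule subsetI, simp)
    fix i assume "deg i \<le> n"
    then have "L * i \<le> M * n + C" using deg_lower[of i] mult_le_mono2[of "deg i" n M] by linarith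
    then show "i \<le> (M * n + C) div L" using L_pos by (simp add: less_eq_div_iff_mult_less_eq mult.commute)
  qed
  from card_mono[OF _ this] have "?F \<le> (M * n + C) div L + 1"
    by (simp add: growth_V[OF assms])
  moreover have "real ((M * n + C) div L) \<le> real (M * n + C) / L"
    by (rule of_nat_div_le_of_nat)
  ultimately have up: "real ?F \<le> (M * n + C) / L + 1" by linarith
  have fin: "finite {i. deg i \<le> n}"
    using \<open>{i. deg i \<le> n} \<subseteq> {..(M * n + C) div L}\<close> finite_subset by blast
  have "{i. L * i + C \<le> M * n} \<subseteq> {i. deg i \<le> n}"
  proof (rule subsetI, simp)
    fix i assume "L * i + C \<le> M * n"
    then have "M * deg i \<le> M * n" using deg_upper[of i] by linarith
    then show "deg i \<le> n" using M_pos by simp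
  qed
  from card_mono[OF fin this] have le: "card {i. L * i + C \<le> M * n} \<le> ?F"
    by (simp add: growth_V[OF assms])
  have low: "real M * n - C \<le> L * real ?F"
  proof (cases "C \<le> M * n")
    case True
    have "{i. L * i + C \<le> M * n} = {..(M * n - C) div L}"
      using True L_pos by (auto simp: less_eq_div_iff_mult_less_eq mult.commute)
    then have "Suc ((M * n - C) div L) \<le> ?F" using le by simp
    then have "L * Suc ((M * n - C) div L) \<le> L * ?F" by (rule mult_le_mono2)
    moreover have "M * n - C \<le> L * Suc ((M * n - C) div L)"
      using L_pos by (simp add: dividend_less_times_div less_imp_le)
    ultimately have "M * n \<le> L * ?F + C" using True by linarith
    then have "real (M * n) \<le> real (L * ?F + C)" by (rule of_nat_mono)
    then show ?thesis by simp
  next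
    case False
    then have "real (M * n) < C" by linarith
    then have "real M * n - C \<le> 0" by simp
    also have "0 \<le> L * real ?F" by simp
    finally show ?thesis .
  qed
  have L: "real L > 0" using L_pos by simp
  have up': "L * real ?F \<le> M * real n + C + L"
    using up L by (simp add: field_simps)
  have "\<bar>L * real ?F - M * real n\<bar> \<le> C + L" using up' low by auto
  moreover have "real ?F / n - M / L = (L * real ?F - M * real n) / (L * real n)"
    using L assms by (simp add: field_simps)
  moreover have "(C / L + 1) * (1 / real n) = (C + real L) / (L * real n)"
    using L assms by (simp add: field_simps)
  ultimately show ?thesis using L assms by (simp add: divide_right_mono)
qed

lemma growth_limit: "(\<lambda>n. real (growth_function V n) / real n) \<longlonglongrightarrow> M / L"
proof (rule LIM_zero_cancel, rule Lim_null_comparison)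
  show "\<forall>\<^sub>F n in sequentially. norm (real (growth_function V n) / real n - M / L) \<le> (C / L + 1) * (1 / real n)"
    using growth_bound by (intro eventually_sequentiallyI[of 1]) simp
  show "(\<lambda>n. (C / L + 1) * (1 / real n)) \<longlonglongrightarrow> 0"
    by (rule tendsto_mult_right_zero[OF lim_1_over_n])
qed

lemma growth_Theta: "(\<lambda>n. real (growth_function V n)) \<in> \<Theta>(\<lambda>n. real n)"
  by (rule bigthetaI_tendsto[OF _ growth_limit])
     (use L_pos M_pos in \<open>auto intro!: eventually_sequentiallyI[of 1]\<close>)

text \<open>
  As \<open>\<alpha> \<noteq> \<beta>\<close>, the fields \<open>X\<^sub>1\<close> and \<open>[X\<^sub>0, X\<^sub>1]\<close> span the same plane as \<open>\<phi>\<^sub>1\<close> and \<open>\<phi>\<^sub>2\<close>.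
\<close>

lemma growth_theorem:
  fixes a b :: 'k
  assumes ab: "a \<noteq> 0" "b \<noteq> 0"
  defines "f \<equiv> (\<lambda>u. a * exp (\<alpha> * of_real u) + b * exp (\<beta> * of_real u))"
  shows "linear_growth \<Omega> (char_lie_algebra \<Omega> f) (char_gen_space \<Omega> f) \<and>
    (\<lambda>n. real (growth_function (char_gen_space \<Omega> f) n) / real n) \<longlonglongrightarrow> M / L"
proof -
  have ne: "\<alpha> \<noteq> \<beta>" using separated[of 1 2] deg_1 deg_2 w1 w2 by auto
  have X1: "X1 \<Omega> f = scale_vf a (\<phi> 1) + scale_vf b (\<phi> 2)"
    unfolding f_def by (rule X1_comb)
  have br: "bracket (\<phi> 0) (X1 \<Omega> f) = scale_vf (a * \<alpha>) (\<phi> 1) + scale_vf (b * \<beta>) (\<phi> 2)"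
    unfolding X1
    unfolding bracket_add_right[OF \<phi>_derivation derivations_scale derivations_scale, OF \<phi>_derivation \<phi>_derivation]
      bracket_scale_right[OF \<phi>_derivation \<phi>_derivation] bracket_\<phi> c_0_left w1 w2 add_0
    by (simp only: vf.scale_scale)
  have X1_der: "X1 \<Omega> f \<in> derivations \<Omega>"
    unfolding X1 by (intro vf.subspace_add[OF subspace_derivations] derivations_scale \<phi>_derivation)
  have gen: "char_gen_space \<Omega> f = V"
    unfolding char_gen_space_def V_def \<phi>_0[symmetric] br
  proof (rule antisym; rule vf.span_minimal[OF _ vf.subspace_span])
    have m: "\<phi> 0 \<in> vf.span {\<phi> 0, \<phi> 1, \<phi> 2}" "\<phi> 1 \<in> vf.span {\<phi> 0, \<phi> 1, \<phi> 2}" "\<phi> 2 \<in> vf.span {\<phi> 0, \<phi> 1, \<phi> 2}"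
      by (auto intro: vf.span_base)
    then show "{\<phi> 0, X1 \<Omega> f, scale_vf (a * \<alpha>) (\<phi> 1) + scale_vf (b * \<beta>) (\<phi> 2)} \<subseteq> vf.span {\<phi> 0, \<phi> 1, \<phi> 2}"
      unfolding X1 by (auto intro!: vf.span_add vf.span_scale m)
  next
    let ?Y = "scale_vf (a * \<alpha>) (\<phi> 1) + scale_vf (b * \<beta>) (\<phi> 2)"
    let ?S = "vf.span {\<phi> 0, X1 \<Omega> f, ?Y}"
    have m: "\<phi> 0 \<in> ?S" "X1 \<Omega> f \<in> ?S" "?Y \<in> ?S"
      by (auto intro: vf.span_base)
    have "scale_vf (a * (\<alpha> - \<beta>)) (\<phi> 1) = ?Y - scale_vf \<beta> (X1 \<Omega> f)"
      unfolding X1 by (simp add: vf.scale_right_distrib algebra_simps vf.scale_left_diff_distrib)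
    also have "\<dots> \<in> ?S" by (intro vf.span_diff vf.span_scale m)
    finally have "scale_vf (inverse (a * (\<alpha> - \<beta>))) (scale_vf (a * (\<alpha> - \<beta>)) (\<phi> 1)) \<in> ?S"
      by (rule vf.span_scale)
    moreover have "inverse (a * (\<alpha> - \<beta>)) * (a * (\<alpha> - \<beta>)) = 1"
      using ab ne by (intro left_inverse) simp
    ultimately have 1: "\<phi> 1 \<in> ?S" by (simp only: vf.scale_scale vf.scale_one)
    have "scale_vf (b * (\<beta> - \<alpha>)) (\<phi> 2) = ?Y - scale_vf \<alpha> (X1 \<Omega> f)"
      unfolding X1 by (simp add: vf.scale_right_distrib algebra_simps vf.scale_left_diff_distrib)
    also have "\<dots> \<in> ?S" by (intro vf.span_diff vf.span_scale m)
    finally have "scale_vf (inverse (b * (\<beta> - \<alpha>))) (scale_vf (b * (\<beta> - \<alpha>)) (\<phi> 2)) \<in> ?S"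
      by (rule vf.span_scale)
    moreover have "inverse (b * (\<beta> - \<alpha>)) * (b * (\<beta> - \<alpha>)) = 1"
      using ab ne by (intro left_inverse) simp
    ultimately have 2: "\<phi> 2 \<in> ?S" by (simp only: vf.scale_scale vf.scale_one)
    show "{\<phi> 0, \<phi> 1, \<phi> 2} \<subseteq> ?S" using m(1) 1 2 by auto
  qed
  have "lie_subalgebra \<Omega> T \<and> {X0 \<Omega>, X1 \<Omega> f} \<subseteq> T \<longleftrightarrow> lie_subalgebra \<Omega> T \<and> char_gen_space \<Omega> f \<subseteq> T" for T
  proof
    assume T: "lie_subalgebra \<Omega> T \<and> {X0 \<Omega>, X1 \<Omega> f} \<subseteq> T"
    then have "bracket (X0 \<Omega>) (X1 \<Omega> f) \<in> T" "vf.subspace T" by (auto simp: lie_subalgebra_def)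
    then show "lie_subalgebra \<Omega> T \<and> char_gen_space \<Omega> f \<subseteq> T"
      using T unfolding char_gen_space_def by (intro conjI vf.span_minimal) auto
  next
    assume "lie_subalgebra \<Omega> T \<and> char_gen_space \<Omega> f \<subseteq> T"
    then show "lie_subalgebra \<Omega> T \<and> {X0 \<Omega>, X1 \<Omega> f} \<subseteq> T"
      using vf.span_superset[of "{X0 \<Omega>, X1 \<Omega> f, bracket (X0 \<Omega>) (X1 \<Omega> f)}"]
      unfolding char_gen_space_def by auto
  qed
  note same = this
  have hull: "char_lie_algebra \<Omega> f = lie_subalgebra \<Omega> hull (char_gen_space \<Omega> f)"
    unfolding char_lie_algebra_def hull_def by (intro arg_cong[where f = Inter] Collect_cong same)
  have "lie_subalgebra \<Omega> (char_lie_algebra \<Omega> f)"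
    unfolding char_lie_algebra_def
    by (rule lie_subalgebra_hull) (simp add: X1_der flip: \<phi>_0)
  moreover have "\<exists>B. finite B \<and> char_gen_space \<Omega> f = vf.span B"
    unfolding char_gen_space_def
    by (rule exI[of _ "{X0 \<Omega>, X1 \<Omega> f, bracket (X0 \<Omega>) (X1 \<Omega> f)}"]) simp
  ultimately show ?thesis
    using growth_Theta growth_limit unfolding linear_growth_def hull gen by simp
qed

end

section \<open>Periodic structure constants\<close>

text \<open>
  The base range starts at 1, where lowering by 1 is still possible, and reaches \<open>N + 1\<close>, so that the
  shift is applied only to \<open>i \<ge> 2\<close>, where \<open>i - 2\<close> is not truncated.
\<close>

lemma periodic_induct:
  fixes i N :: nat
  assumes "0 < N" "0 < i"
    and base: "\<And>i. i \<in> {1..N + 1} \<Longrightarrow> P i"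
    and shift: "\<And>i. 2 \<le> i \<Longrightarrow> P i \<Longrightarrow> P (i + N)"
  shows "P i"
  using assms(2)
proof (induction i rule: less_induct)
  case (less i)
  show ?case
  proof (cases "i \<le> N + 1")
    case True
    with less.prems base show ?thesis by simp
  next
    case False
    then have "P (i - N)" using less.IH[of "i - N"] assms(1) by simp
    with shift[of "i - N"] False show ?thesis by simp
  qed
qed

text \<open>
  Finitely many numerical checks imply all assumptions on the structure constants once the data
  repeat with period \<open>N\<close>, the degree growing by \<open>D\<close> in each period.
\<close>

locale periodic_data =
  fixes N D L M C :: nat and \<alpha> \<beta> :: "'k::{real_normed_field,banach}"
    and w p q :: "nat \<Rightarrow> 'k" and c :: "nat \<Rightarrow> nat \<Rightarrow> 'k" and deg :: "nat \<Rightarrow> nat"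
  assumes pos: "0 < N" "0 < D" "0 < L" "0 < M" and slope: "L * N = M * D"
    and period: "\<And>i. w (i + N) = w i" "\<And>i. p (i + N) = p i" "\<And>i. q (i + N) = q i"
      "\<And>i j. c (i + N) j = c i j" "\<And>i j. c i (j + N) = c i j" "\<And>i. deg (i + N) = deg i + D"
    and start: "w 0 = 0" "w 1 = \<alpha>" "w 2 = \<beta>" "p 1 = 1" "q 1 = 0" "p 2 = 0" "q 2 = 1"
      "deg 0 = 0" "deg 1 = 1" "deg 2 = 1" "c 0 0 = 0" "c 1 1 = 0"
    and lowering: "\<And>i. i \<in> {1..N + 1} \<Longrightarrow>
      p i * (\<alpha> + w (i - 1)) = p i * w i \<and> q i * (\<beta> + w (i - 2)) = q i * w i \<and> p i + q i = 1 \<and>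
      (p i \<noteq> 0 \<longrightarrow> deg i = Suc (deg (i - 1))) \<and> (q i \<noteq> 0 \<longrightarrow> deg i = Suc (deg (i - 2)))"
    and weights: "\<And>i. i \<in> {1..N + 1} \<Longrightarrow> c 0 i = w i \<and> c i 0 = - w i"
    and slopes: "\<And>i. i \<in> {1..N + 1} \<Longrightarrow> L * i \<le> M * deg i + C \<and> M * deg i \<le> L * i + C"
    and jacobi: "\<And>i j. i \<in> {1..N + 1} \<Longrightarrow> j \<in> {1..N + 1} \<Longrightarrow>
      p i * c (i - 1) j + p j * c i (j - 1) = c i j * p (i + j) \<and>
      q i * c (i - 2) j + q j * c i (j - 2) = c i j * q (i + j) \<and>
      (c i j \<noteq> 0 \<longrightarrow> deg (i + j) = deg i + deg j)"
    and generators: "\<And>i. i \<in> {1..N + 1} \<Longrightarrow>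
      c 1 (i + 1) \<noteq> 0 \<and> deg (i + 2) = Suc (deg (i + 1)) \<or> c 2 i \<noteq> 0 \<and> deg (i + 2) = Suc (deg i)"
    and distinct: "\<And>s t. s < N \<Longrightarrow> t < N \<Longrightarrow> w s = w t \<Longrightarrow> deg s mod D = deg t mod D \<Longrightarrow> s = t"
begin

lemma shift_down: "2 \<le> i \<Longrightarrow> i + N - 1 = i - 1 + N" "2 \<le> i \<Longrightarrow> i + N - 2 = i - 2 + N"
  "i + N + j = i + j + N" "j + (i + N) = j + i + N"
  by simp_all

lemma lowering_all: "0 < i \<Longrightarrow>
    p i * (\<alpha> + w (i - 1)) = p i * w i \<and> q i * (\<beta> + w (i - 2)) = q i * w i \<and> p i + q i = 1 \<and>
    (p i \<noteq> 0 \<longrightarrow> deg i = Suc (deg (i - 1))) \<and> (q i \<noteq> 0 \<longrightarrow> deg i = Suc (deg (i - 2)))"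
  (is "_ \<Longrightarrow> ?P i")
proof (erule periodic_induct[OF pos(1)])
  fix i assume "2 \<le> i" "?P i"
  then show "?P (i + N)" by (simp only: shift_down period) simp
qed (rule lowering)

lemma weights_all: "c 0 i = w i \<and> c i 0 = - w i"
proof (cases "i = 0")
  case False
  then have "0 < i" by simp
  then show ?thesis
  proof (rule periodic_induct[OF pos(1)])
    fix i assume "c 0 i = w i \<and> c i 0 = - w i"
    then show "c 0 (i + N) = w (i + N) \<and> c (i + N) 0 = - w (i + N)" by (simp only: period)
  qed (rule weights)
qed (use start in simp)

lemma slopes_all: "L * i \<le> M * deg i + C \<and> M * deg i \<le> L * i + C"
proof (cases "i = 0")
  case False
  then have "0 < i" by simp
  then show ?thesis
  proof (rule periodic_induct[OF pos(1)])
    fix i assume "L * i \<le> M * deg i + C \<and> M * deg i \<le> L * i + C"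
    then show "L * (i + N) \<le> M * deg (i + N) + C \<and> M * deg (i + N) \<le> L * (i + N) + C"
      by (simp add: period distrib_left slope)
  qed (rule slopes)
qed (use start in simp)

lemma jacobi_all:
  assumes "0 < i" "0 < j"
  shows "p i * c (i - 1) j + p j * c i (j - 1) = c i j * p (i + j) \<and>
    q i * c (i - 2) j + q j * c i (j - 2) = c i j * q (i + j) \<and>
    (c i j \<noteq> 0 \<longrightarrow> deg (i + j) = deg i + deg j)" (is "?P i j")
proof (rule periodic_induct[OF pos(1) assms(1)])
  fix i assume i: "i \<in> {1..N + 1}"
  show "?P i j"
  proof (rule periodic_induct[OF pos(1) assms(2)])
    fix j assume "2 \<le> j" "?P i j"
    then show "?P i (j + N)" by (simp only: shift_down period) simp
  qed (rule jacobi[OF i])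
next
  fix i assume "2 \<le> i" "?P i j"
  then show "?P (i + N) j" by (simp only: shift_down period) simp
qed

lemma generators_all:
  assumes "3 \<le> i"
  shows "c 1 (i - 1) \<noteq> 0 \<and> deg i = Suc (deg (i - 1)) \<or> c 2 (i - 2) \<noteq> 0 \<and> deg i = Suc (deg (i - 2))"
proof -
  have "0 < i - 2" using assms by simp
  then have "c 1 (i - 2 + 1) \<noteq> 0 \<and> deg (i - 2 + 2) = Suc (deg (i - 2 + 1)) \<or>
      c 2 (i - 2) \<noteq> 0 \<and> deg (i - 2 + 2) = Suc (deg (i - 2))" (is "?P (i - 2)")
  proof (rule periodic_induct[OF pos(1)])
    fix i assume "?P i"
    then show "?P (i + N)" by (simp only: shift_down period) simp
  qed (rule generators)
  moreover have "i - 2 + 1 = i - 1" "i - 2 + 2 = i" using assms by simp_all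
  ultimately show ?thesis by simp
qed

lemma separated:
  assumes "deg i = deg j" "w i = w j"
  shows "i = j"
proof -
  have w: "w (s + N * x) = w s" and deg: "deg (s + N * x) = deg s + D * x" for s x
  proof (induction x)
    case (Suc x)
    have e: "s + N * Suc x = (s + N * x) + N" by simp
    { case 1 show ?case unfolding e period by (rule Suc) }
    { case 2 show ?case unfolding e period using Suc by simp }
  qed simp_all
  have d: "deg (i mod N) + D * (i div N) = deg (j mod N) + D * (j div N)"
    using assms(1) deg[of "i mod N" "i div N"] deg[of "j mod N" "j div N"] by simp
  have "i mod N = j mod N"
  proof (rule distinct)
    show "w (i mod N) = w (j mod N)"
      using assms(2) w[of "i mod N" "i div N"] w[of "j mod N" "j div N"] by simp
    show "deg (i mod N) mod D = deg (j mod N) mod D"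
      using arg_cong[OF d, of "\<lambda>d. d mod D"] by simp
  qed (use pos(1) in simp_all)
  moreover from this have "i div N = j div N"
    using d pos(2) by simp
  ultimately show ?thesis by (metis div_mult_mod_eq)
qed

lemma graded:
  assumes "open \<Omega>" "\<Omega> \<noteq> {}"
  shows "char_graded \<Omega> \<alpha> \<beta> w p q c deg L M C"
proof
  show "deg (i + j) \<le> deg i + deg j" if "c i j \<noteq> 0" for i j
    using jacobi_all[of i j] that start by (cases "i = 0"; cases "j = 0") auto
next
  fix i j :: nat
  assume i: "0 < i"
  from lowering_all[OF i] show "p i * (\<alpha> + w (i - 1)) = p i * w i" "q i * (\<beta> + w (i - 2)) = q i * w i"
    "p i + q i = 1" "p i \<noteq> 0 \<Longrightarrow> deg i = Suc (deg (i - 1))" "q i \<noteq> 0 \<Longrightarrow> deg i = Suc (deg (i - 2))"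
    by simp_all
  assume j: "0 < j"
  from jacobi_all[OF i j] show "p i * c (i - 1) j + p j * c i (j - 1) = c i j * p (i + j)"
    "q i * c (i - 2) j + q j * c i (j - 2) = c i j * q (i + j)"
    by simp_all
next
  fix i :: nat
  show "c 0 i = w i" "c i 0 = - w i" using weights_all[of i] by simp_all
  show "L * i \<le> M * deg i + C" "M * deg i \<le> L * i + C" using slopes_all[of i] by simp_all
qed (rule assms pos start generators_all separated; assumption)+

end

section \<open>The two characteristic algebras\<close>

definition cyclic :: "'a list \<Rightarrow> nat \<Rightarrow> 'a" where
  "cyclic xs i = xs ! (i mod length xs)"

text \<open>
  \<open>A\<^sub>1\<^sup>(\<^sup>1\<^sup>)\<close>: up to signs, \<open>\<phi>\<^bsub>3k\<^esub>\<close>, \<open>\<phi>\<^bsub>3k+1\<^esub>\<close>, \<open>\<phi>\<^bsub>3k+2\<^esub>\<close> are the elements \<open>h t\<^sup>k / 2\<close>, \<open>e t\<^sup>k\<close> and \<open>f\<close> times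
  \<open>t\<close> to the power \<open>k + 1\<close> of the loop algebra of \<open>sl\<^sub>2\<close>.
\<close>

definition sinh_w :: "nat \<Rightarrow> 'k::field" where "sinh_w = cyclic [0, 1, - 1]"

definition sinh_p :: "nat \<Rightarrow> 'k::field" where "sinh_p = cyclic [1 / 2, 1, 0]"

definition sinh_q :: "nat \<Rightarrow> 'k::field" where "sinh_q = cyclic [1 / 2, 0, 1]"

definition sinh_c :: "nat \<Rightarrow> nat \<Rightarrow> 'k::field" where
  "sinh_c i j =
    [[0, 1, - 1],
     [- 1, 0, - 2],
     [1, 2, 0]] ! (i mod 3) ! (j mod 3)"

definition sinh_deg :: "nat \<Rightarrow> nat" where "sinh_deg i = 2 * (i div 3) + cyclic [0, 1, 1] i"

lemma sinh_periodic:
  "periodic_data 3 2 2 3 1 (1::'k::{real_normed_field,banach}) (- 1) sinh_w sinh_p sinh_q sinh_c sinh_deg"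
proof -
  note defs = sinh_w_def sinh_p_def sinh_q_def sinh_c_def sinh_deg_def cyclic_def
  have range: "i \<in> {1..3 + 1} \<longleftrightarrow> i = 1 \<or> i = 2 \<or> i = 3 \<or> i = 4" for i :: nat
    by auto
  have below: "i < 3 \<longleftrightarrow> i = 0 \<or> i = 1 \<or> i = 2" for i :: nat
    by auto
  show ?thesis
    by unfold_locales
      (unfold range below, ((simp add: defs; fail) | (elim disjE; simp add: defs))+)
qed

text \<open>
  \<open>A\<^sub>2\<^sup>(\<^sup>2\<^sup>)\<close>: for \<open>i = 1, \<dots>, 8\<close> the root of \<open>\<phi>\<^sub>i\<close>, as a pair of multiplicities of the simple roots with
  weights 1 and -2, is \<open>(1,0), (0,1), (1,1), (2,1), (3,1), (4,1), (3,2), (4,2)\<close>, and adding \<open>(4,2)\<close>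
  raises the index by 8.  The values of \<open>p\<close> at roots from which both simple roots can be subtracted,
  here \<open>2 / 3\<close> and \<open>1 / 3\<close>, are those for which the Jacobi identities have a solution \<open>c\<close>.
\<close>

definition tzitzeica_w :: "nat \<Rightarrow> 'k::field" where "tzitzeica_w = cyclic [0, 1, - 2, - 1, 0, 1, 2, - 1]"

definition tzitzeica_p :: "nat \<Rightarrow> 'k::field" where "tzitzeica_p = cyclic [1 / 3, 1, 0, 2 / 3, 1, 1, 1, 0]"

definition tzitzeica_q :: "nat \<Rightarrow> 'k::field" where "tzitzeica_q = cyclic [2 / 3, 0, 1, 1 / 3, 0, 0, 0, 1]"

definition tzitzeica_c :: "nat \<Rightarrow> nat \<Rightarrow> 'k::field" where
  "tzitzeica_c i j =
    [[0, 1, - 2, - 1, 0, 1, 2, - 1],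
     [- 1, 0, - 3, - 3, - 3, - 2, 0, - 3],
     [2, 3, 0, 0, 0, 1, 3, 0],
     [1, 3, 0, 0, - 1, - 1, 1, - 2],
     [0, 3, 0, 1, 0, - 1, 0, - 3],
     [- 1, 2, - 1, 1, 1, 0, 0, - 3],
     [- 2, 0, - 3, - 1, 0, 0, 0, - 3],
     [1, 3, 0, 2, 3, 3, 3, 0]] ! (i mod 8) ! (j mod 8)"

definition tzitzeica_deg :: "nat \<Rightarrow> nat" where "tzitzeica_deg i = 6 * (i div 8) + cyclic [0, 1, 1, 2, 3, 4, 5, 5] i"

lemma tzitzeica_periodic:
  "periodic_data 8 6 3 4 2 (1::'k::{real_normed_field,banach}) (- 2) tzitzeica_w tzitzeica_p tzitzeica_q tzitzeica_c tzitzeica_deg"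
proof -
  note defs = tzitzeica_w_def tzitzeica_p_def tzitzeica_q_def tzitzeica_c_def tzitzeica_deg_def cyclic_def
  have range: "i \<in> {1..8 + 1} \<longleftrightarrow> i = 1 \<or> i = 2 \<or> i = 3 \<or> i = 4 \<or> i = 5 \<or> i = 6 \<or> i = 7 \<or> i = 8 \<or> i = 9" for i :: nat
    by auto
  have below: "i < 8 \<longleftrightarrow> i = 0 \<or> i = 1 \<or> i = 2 \<or> i = 3 \<or> i = 4 \<or> i = 5 \<or> i = 6 \<or> i = 7" for i :: nat
    by auto
  show ?thesis
    by unfold_locales
      (unfold range below, ((simp add: defs; fail) | (elim disjE; simp add: defs))+)
qed

lemma sinh_growth:
  assumes "open \<Omega>" "\<Omega> \<noteq> {}"
  defines "f \<equiv> (\<lambda>u. sinh (of_real u) :: 'k::{real_normed_field,banach})"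
  shows "linear_growth \<Omega> (char_lie_algebra \<Omega> f) (char_gen_space \<Omega> f)"
    and "(\<lambda>n. real (growth_function (char_gen_space \<Omega> f) n) / real n) \<longlonglongrightarrow> 3 / 2"
proof -
  have f: "f = (\<lambda>u. 1 / 2 * exp (1 * of_real u) + - 1 / 2 * exp (- 1 * of_real u))"
    by (simp add: f_def sinh_field_def field_simps)
  have "(1 / 2 :: 'k) \<noteq> 0" "(- 1 / 2 :: 'k) \<noteq> 0" by simp_all
  from char_graded.growth_theorem[OF periodic_data.graded[OF sinh_periodic assms(1,2)] this]
  show "linear_growth \<Omega> (char_lie_algebra \<Omega> f) (char_gen_space \<Omega> f)"
    and "(\<lambda>n. real (growth_function (char_gen_space \<Omega> f) n) / real n) \<longlonglongrightarrow> 3 / 2"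
    unfolding f by simp_all
qed

lemma tzitzeica_growth:
  assumes "open \<Omega>" "\<Omega> \<noteq> {}"
  defines "f \<equiv> (\<lambda>u. exp (of_real u) + exp (- 2 * of_real u) :: 'k::{real_normed_field,banach})"
  shows "linear_growth \<Omega> (char_lie_algebra \<Omega> f) (char_gen_space \<Omega> f)"
    and "(\<lambda>n. real (growth_function (char_gen_space \<Omega> f) n) / real n) \<longlonglongrightarrow> 4 / 3"
proof -
  have f: "f = (\<lambda>u. 1 * exp (1 * of_real u) + 1 * exp (- 2 * of_real u))"
    by (simp add: f_def)
  have "(1 :: 'k) \<noteq> 0" "(1 :: 'k) \<noteq> 0" by simp_all
  from char_graded.growth_theorem[OF periodic_data.graded[OF tzitzeica_periodic assms(1,2)] this]
  show "linear_growth \<Omega> (char_lie_algebra \<Omega> f) (char_gen_space \<Omega> f)"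
    and "(\<lambda>n. real (growth_function (char_gen_space \<Omega> f) n) / real n) \<longlonglongrightarrow> 4 / 3"
    unfolding f by simp_all
qed

theorem mainTheorem3:
  fixes \<Omega> :: "real set"
  assumes "open \<Omega>" and "is_interval \<Omega>" and "\<Omega> \<noteq> {}"
  shows
    "linear_growth \<Omega>
       (char_lie_algebra \<Omega> (\<lambda>u. sinh u :: real))
       (char_gen_space \<Omega> (\<lambda>u. sinh u :: real)) \<and>
     (\<lambda>n. real (growth_function
         (char_gen_space \<Omega> (\<lambda>u. sinh u :: real)) n) / real n)
       \<longlonglongrightarrow> 3 / 2 \<and>
     linear_growth \<Omega>
       (char_lie_algebra \<Omega> (\<lambda>u. exp u + exp (- 2 * u) :: real))
       (char_gen_space \<Omega> (\<lambda>u. exp u + exp (- 2 * u) :: real)) \<and>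
     (\<lambda>n. real (growth_function
         (char_gen_space \<Omega> (\<lambda>u. exp u + exp (- 2 * u) :: real)) n) / real n)
       \<longlonglongrightarrow> 4 / 3 \<and>
     linear_growth \<Omega>
       (char_lie_algebra \<Omega> (\<lambda>u. sinh (complex_of_real u)))
       (char_gen_space \<Omega> (\<lambda>u. sinh (complex_of_real u))) \<and>
     (\<lambda>n. real (growth_function
         (char_gen_space \<Omega> (\<lambda>u. sinh (complex_of_real u))) n) / real n)
       \<longlonglongrightarrow> 3 / 2 \<and>
     linear_growth \<Omega>
       (char_lie_algebra \<Omega> (\<lambda>u. exp (complex_of_real u) + exp (- 2 * complex_of_real u)))
       (char_gen_space \<Omega> (\<lambda>u. exp (complex_of_real u) + exp (- 2 * complex_of_real u))) \<and>
     (\<lambda>n. real (growth_function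
         (char_gen_space \<Omega> (\<lambda>u. exp (complex_of_real u) + exp (- 2 * complex_of_real u))) n) / real n)
       \<longlonglongrightarrow> 4 / 3"
  using sinh_growth[OF assms(1,3), where 'k = real] tzitzeica_growth[OF assms(1,3), where 'k = real]
    sinh_growth[OF assms(1,3), where 'k = complex] tzitzeica_growth[OF assms(1,3), where 'k = complex]
  by (intro conjI) (simp_all only: of_real_eq_id id_apply)

end
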